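(* Let $l\ge 2$, let $\mathcal{W}$ be the affine Weyl group of $\widehat{\mathfrak{sl}}_l$, and let $\widetilde{\mathcal{G}}$ be the set of translated good monomials. The map $w:\widetilde{\mathcal{G}}\to\mathcal{W}$ sending $M$ to $w_M$ is bijective.
   Context: Root data. $\alpha_0,\dots,\alpha_{l-1}$ are the simple roots and $\Lambda_0,\dots,\Lambda_{l-1}$ the fundamental weights of $\widehat{\mathfrak{sl}}_l$, $\delta=\sum_i\alpha_i$, $\mathfrak{h}^*=\bigoplus_i\mathbb{C}\Lambda_i\oplus\mathbb{C}\delta$ with invariant form normalized by $(\alpha_i,\alpha_i)=2$. With $\epsilon_1,\dots,\epsilon_l$ orthonormal and $\overline{\epsilon}_i=\epsilon_i-\frac1l\sum_j\epsilon_j$, one has $\Lambda_i-\Lambda_0=\overline{\epsilon}_1+\cdots+\overline{\epsilon}_i$, and $\alpha_{ij}=\alpha_i+\cdots+\alpha_{j-1}=\overline{\epsilon}_i-\overline{\epsilon}_j$ for $1\le i<j\le l$. Weyl groups. The extended affine Weyl group is $\widetilde{\mathcal{W}}\simeq\overset{\circ}{P}\rtimes\mathfrak{S}_l$, $\overset{\circ}{P}=\bigoplus_{i=1}^{l-1}\mathbb{Z}(\Lambda_i-\Lambda_0)$. An element $\gamma\cdot\sigma$ ($\gamma\in\overset{\circ}{P}$, $\sigma\in\mathfrak{S}_l$) acts on $\mathfrak{h}^*$ by $\mu\mapsto t_\gamma(\sigma(\mu))$, where $\sigma(\Lambda_0)=\Lambda_0$, $\sigma(\delta)=\delta$, $\sigma(\overline{\epsilon}_i)=\overline{\epsilon}_{\sigma(i)}$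 and $t_\gamma(\mu)=\mu+(\mu,\delta)\gamma-(\frac12(\mu,\delta)(\gamma,\gamma)+(\gamma,\mu))\delta$. The affine Weyl group is the subgroup $\mathcal{W}\simeq\overset{\circ}{Q}\rtimes\mathfrak{S}_l$, $\overset{\circ}{Q}=\bigoplus_{i=1}^{l-1}\mathbb{Z}\alpha_i$. For a real root $\gamma$, $r_\gamma\in\mathcal{W}$ is the reflection in $\gamma$. Put $s=\overline{\epsilon}_2\cdot\sigma\in\widetilde{\mathcal{W}}$ with $\sigma=(2\,3\,\cdots\,l)$, and $\mathrm{Ad}_s(w)=sws^{-1}$. Good monomials. A monomial of degree $n\ge0$ is a word $M=C_1C_2\cdots C_n$ in the letters $A,B$ (the empty word is $1$). It is good if $C_i=A$ implies $C_{i+l-1}=A$ for $i=1,\dots,n-l+1$. $\mathcal{G}$ is the set of good monomials with $n=0$ or $C_n=B$. If $M\in\mathcal{G}$ then $BM\in\mathcal{G}$. Translated good monomials. Introduce a formal inverse $B^{-1}$ with $B^{-1}B=BB^{-1}=1$ and set $\widetilde{\mathcal{G}}=\{B^{-n}M\mid n\ge0,\ M\in\mathcal{G}\}$; thus $B^{-n}M=B^{-n'}M'$ iff $B^{n'}M=B^{n}M'$ as words. The element $w_M$. Let $\beta_{m(l-1)+r}=\alpha_{1,r+1}+m\delta$ for $m\ge 0$, $1\le r\le l-1$. For $M=C_1\cdots C_n\in\mathcal{G}$, delete from $\beta_1,\dots,\beta_n$ all $\beta_i$ with $C_i=A$, call the remaining sequence (in order) $\gamma_1,\dots,\gamma_p$,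 and set $w_M=r_{\gamma_p}\cdots r_{\gamma_1}$ ($w_1=1$). Extend to $\widetilde{\mathcal{G}}$ by $w_{B^{-1}M}=\mathrm{Ad}_s^{-1}(w_Mr_{\alpha_{12}})$; this is well defined. *)

theory Defs
  imports
    Complex_Main
    "HOL-Library.Function_Algebras"
    "HOL-Library.Product_Plus"
    "HOL-Algebra.Bij"
    "HOL-Combinatorics.Cycles"
begin

section \<open>The space \<open>\<hh>\<^sup>*\<close>\<close>

text \<open>
  A triple \<open>(x, k, d)\<close> stands for \<open>(\<Sum>i=1..l. x i \<epsilon>\<^sub>i) + k \<Lambda>\<^sub>0 + d \<delta>\<close>.
  These triples form a larger space than \<open>\<hh>\<^sup>*\<close>, which is the subspace \<open>hstar\<close>
  spanned by the fundamental weights and \<open>\<delta>\<close>; all group elements below are bijections of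
  \<open>hstar\<close>, extensional in the sense of \<^const>\<open>Bij\<close>.
\<close>

type_synonym hvec = "(nat \<Rightarrow> complex) \<times> complex \<times> complex"

definition hscale :: "complex \<Rightarrow> hvec \<Rightarrow> hvec" where
  "hscale c v = (case v of (x, k, d) \<Rightarrow> (\<lambda>i. c * x i, c * k, c * d))"

text \<open>
  The invariant form: the \<open>\<epsilon>\<^sub>i\<close> are orthonormal and orthogonal to \<open>\<Lambda>\<^sub>0\<close> and \<open>\<delta>\<close>, the vectors
  \<open>\<Lambda>\<^sub>0\<close> and \<open>\<delta>\<close> are isotropic, and their product is 1.
\<close>

definition hform :: "nat \<Rightarrow> hvec \<Rightarrow> hvec \<Rightarrow> complex" where
  "hform l v w = (case v of (x, k, d) \<Rightarrow> case w of (x', k', d') \<Rightarrow>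
     (\<Sum>i=1..l. x i * x' i) + k * d' + d * k')"

definition delta :: hvec where
  "delta = (0, 0, 1)"

definition Lambda0 :: hvec where
  "Lambda0 = (0, 1, 0)"

definition eps :: "nat \<Rightarrow> hvec" where
  "eps i = (\<lambda>j. if j = i then 1 else 0, 0, 0)"

definition eps_bar :: "nat \<Rightarrow> nat \<Rightarrow> hvec" where
  "eps_bar l i = eps i - hscale (1 / of_nat l) (\<Sum>j=1..l. eps j)"

definition Lambda :: "nat \<Rightarrow> nat \<Rightarrow> hvec" where
  "Lambda l i = Lambda0 + (\<Sum>j=1..i. eps_bar l j)"

definition hstar :: "nat \<Rightarrow> hvec set" where
  "hstar l = {(\<Sum>i<l. hscale (a i) (Lambda l i)) + hscale d delta | a d. True}"

definition simple_root :: "nat \<Rightarrow> nat \<Rightarrow> hvec" where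
  "simple_root l i =
     (if i = 0 then delta - (eps_bar l 1 - eps_bar l l) else eps_bar l i - eps_bar l (Suc i))"

definition fin_root :: "nat \<Rightarrow> nat \<Rightarrow> nat \<Rightarrow> hvec" where
  "fin_root l i j = (\<Sum>k=i..<j. simple_root l k)"

lemma fin_root_eq: "1 \<le> i \<Longrightarrow> i < j \<Longrightarrow> fin_root l i j = eps_bar l i - eps_bar l j"
proof (induction j)
  case (Suc j)
  then show ?case
    by (cases "i = j") (auto simp: fin_root_def simple_root_def)
qed simp

lemma sum_simple_roots: "2 \<le> l \<Longrightarrow> (\<Sum>i<l. simple_root l i) = delta"
proof -
  assume l: "2 \<le> l"
  have "(\<Sum>i<l. simple_root l i) = simple_root l 0 + fin_root l 1 l"
    using l by (simp add: fin_root_def sum.atLeast_Suc_lessThan lessThan_atLeast0)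
  then show ?thesis
    using l by (simp add: fin_root_eq simple_root_def)
qed

section \<open>The affine and extended affine Weyl groups\<close>

text \<open>Permutation of the \<open>\<epsilon>\<^sub>i\<close>; here \<open>inv_into UNIV \<sigma>\<close> is the inverse permutation.\<close>

definition perm_act :: "(nat \<Rightarrow> nat) \<Rightarrow> hvec \<Rightarrow> hvec" where
  "perm_act \<sigma> v = (case v of (x, k, d) \<Rightarrow> (\<lambda>i. x (inv_into UNIV \<sigma> i), k, d))"

lemma perm_act_simps:
  "perm_act \<sigma> (v + w) = perm_act \<sigma> v + perm_act \<sigma> w"
  "perm_act \<sigma> (v - w) = perm_act \<sigma> v - perm_act \<sigma> w"
  "perm_act \<sigma> (hscale c v) = hscale c (perm_act \<sigma> v)"
  "perm_act \<sigma> Lambda0 = Lambda0"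
  "perm_act \<sigma> delta = delta"
  by (auto simp: perm_act_def hscale_def Lambda0_def delta_def split: prod.splits)

lemma perm_act_eps_bar:
  assumes "\<sigma> permutes {1..l}"
  shows "perm_act \<sigma> (eps_bar l i) = eps_bar l (\<sigma> i)"
proof -
  have eps: "perm_act \<sigma> (eps j) = eps (\<sigma> j)" for j
    using permutes_inverses[OF assms] by (auto simp: perm_act_def eps_def fun_eq_iff)
  have "perm_act \<sigma> (\<Sum>j\<in>J. eps j) = (\<Sum>j\<in>J. eps (\<sigma> j))" for J
    by (induction J rule: infinite_finite_induct)
       (auto simp: perm_act_simps eps, auto simp: perm_act_def zero_prod_def)
  also have "(\<Sum>j=1..l. eps (\<sigma> j)) = (\<Sum>j=1..l. eps j)"
    using sum.permute[OF assms, of eps] by (simp add: o_def)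
  finally show ?thesis
    by (simp add: eps_bar_def perm_act_simps eps)
qed

definition transl :: "nat \<Rightarrow> hvec \<Rightarrow> hvec \<Rightarrow> hvec" where
  "transl l \<gamma> \<mu> = \<mu> + hscale (hform l \<mu> delta) \<gamma>
     - hscale (1/2 * hform l \<mu> delta * hform l \<gamma> \<gamma> + hform l \<gamma> \<mu>) delta"

text \<open>The element \<open>\<gamma> \<cdot> \<sigma>\<close>.\<close>

definition aff_elem :: "nat \<Rightarrow> hvec \<Rightarrow> (nat \<Rightarrow> nat) \<Rightarrow> hvec \<Rightarrow> hvec" where
  "aff_elem l \<gamma> \<sigma> = (\<lambda>\<mu>\<in>hstar l. transl l \<gamma> (perm_act \<sigma> \<mu>))"

definition P_fin :: "nat \<Rightarrow> hvec set" where
  "P_fin l = {(\<Sum>i=1..<l. hscale (of_int (n i)) (Lambda l i - Lambda l 0)) | n :: nat \<Rightarrow> int. True}"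

definition Q_fin :: "nat \<Rightarrow> hvec set" where
  "Q_fin l = {(\<Sum>i=1..<l. hscale (of_int (n i)) (simple_root l i)) | n :: nat \<Rightarrow> int. True}"

text \<open>Both groups are subgroups of \<open>BijGroup (hstar l)\<close>, whose product is composition on \<open>hstar l\<close>.\<close>

definition ext_affine_weyl :: "nat \<Rightarrow> (hvec \<Rightarrow> hvec) set" where
  "ext_affine_weyl l = {aff_elem l \<gamma> \<sigma> | \<gamma> \<sigma>. \<gamma> \<in> P_fin l \<and> \<sigma> permutes {1..l}}"

definition affine_weyl :: "nat \<Rightarrow> (hvec \<Rightarrow> hvec) set" where
  "affine_weyl l = {aff_elem l \<gamma> \<sigma> | \<gamma> \<sigma>. \<gamma> \<in> Q_fin l \<and> \<sigma> permutes {1..l}}"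

definition reflection :: "nat \<Rightarrow> hvec \<Rightarrow> hvec \<Rightarrow> hvec" where
  "reflection l \<gamma> = (\<lambda>\<mu>\<in>hstar l. \<mu> - hscale (2 * hform l \<mu> \<gamma> / hform l \<gamma> \<gamma>) \<gamma>)"

definition s_elem :: "nat \<Rightarrow> hvec \<Rightarrow> hvec" where
  "s_elem l = aff_elem l (eps_bar l 2) (cycle_of_list [2..<Suc l])"

definition Ad_s_inv :: "nat \<Rightarrow> (hvec \<Rightarrow> hvec) \<Rightarrow> hvec \<Rightarrow> hvec" where
  "Ad_s_inv l w =
     inv\<^bsub>BijGroup (hstar l)\<^esub> (s_elem l) \<otimes>\<^bsub>BijGroup (hstar l)\<^esub> w \<otimes>\<^bsub>BijGroup (hstar l)\<^esub> s_elem l"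

section \<open>Good monomials\<close>

datatype letter = LA | LB

type_synonym monomial = "letter list"

text \<open>Lists are indexed from 0: the letter \<open>C\<^sub>i\<close> of \<open>M\<close> is \<open>M ! (i - 1)\<close>.\<close>

definition good :: "nat \<Rightarrow> monomial \<Rightarrow> bool" where
  "good l M \<longleftrightarrow> (\<forall>i. i + (l - 1) < length M \<longrightarrow> M ! i = LA \<longrightarrow> M ! (i + (l - 1)) = LA)"

definition good_monomials :: "nat \<Rightarrow> monomial set" where
  "good_monomials l = {M. good l M \<and> (M = [] \<or> last M = LB)}"

text \<open>
  The pair \<open>(n, M)\<close> stands for \<open>B\<^sup>-\<^sup>n M\<close>, and \<open>B\<^sup>-\<^sup>n M = B\<^sup>-\<^sup>n\<^sup>' M'\<close> iff \<open>B\<^sup>n\<^sup>' M = B\<^sup>n M'\<close>.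
\<close>

definition translate_rel :: "nat \<Rightarrow> ((nat \<times> monomial) \<times> (nat \<times> monomial)) set" where
  "translate_rel l = {((n, M), (n', M')). M \<in> good_monomials l \<and> M' \<in> good_monomials l \<and>
     replicate n' LB @ M = replicate n LB @ M'}"

lemma equiv_translate_rel: "equiv (UNIV \<times> good_monomials l) (translate_rel l)"
proof (rule equivI)
  show "trans (translate_rel l)"
  proof (rule transI)
    fix x y z
    assume xy: "(x, y) \<in> translate_rel l" and yz: "(y, z) \<in> translate_rel l"
    obtain n M n' M' n'' M'' where [simp]: "x = (n, M)" "y = (n', M')" "z = (n'', M'')"
      by (cases x, cases y, cases z) auto
    have "replicate n' LB @ replicate n'' LB @ M = replicate n'' LB @ replicate n' LB @ M"
      by (simp flip: append_assoc replicate_add add: add.commute)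
    also have "\<dots> = replicate n'' LB @ replicate n LB @ M'"
      using xy by (simp add: translate_rel_def)
    also have "\<dots> = replicate n LB @ replicate n'' LB @ M'"
      by (simp flip: append_assoc replicate_add add: add.commute)
    also have "\<dots> = replicate n LB @ replicate n' LB @ M''"
      using yz by (simp add: translate_rel_def)
    also have "\<dots> = replicate n' LB @ replicate n LB @ M''"
      by (simp flip: append_assoc replicate_add add: add.commute)
    finally show "(x, z) \<in> translate_rel l"
      using xy yz by (simp add: translate_rel_def)
  qed
qed (auto simp: translate_rel_def refl_on_def sym_def)

definition translated_good_monomials :: "nat \<Rightarrow> (nat \<times> monomial) set set" where
  "translated_good_monomials l = (UNIV \<times> good_monomials l) // translate_rel l"

section \<open>The element \<open>w\<^sub>M\<close>\<close>

text \<open>For \<open>k = m (l - 1) + r\<close> with \<open>1 \<le> r \<le> l - 1\<close> this is \<open>\<alpha>\<^bsub>1,r+1\<^esub> + m \<delta>\<close>.\<close>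

definition beta :: "nat \<Rightarrow> nat \<Rightarrow> hvec" where
  "beta l k = (let m = (k - 1) div (l - 1); r = (k - 1) mod (l - 1) + 1
     in fin_root l 1 (r + 1) + hscale (of_nat m) delta)"

lemma beta_eq:
  assumes "1 \<le> r" "r \<le> l - 1"
  shows "beta l (m * (l - 1) + r) = fin_root l 1 (r + 1) + hscale (of_nat m) delta"
proof -
  have *: "m * (l - 1) + r - 1 = m * (l - 1) + (r - 1)" and "r - 1 < l - 1"
    using assms by auto
  then have "(m * (l - 1) + r - 1) div (l - 1) = m" "(m * (l - 1) + r - 1) mod (l - 1) = r - 1"
    unfolding * by auto
  then show ?thesis
    using assms by (simp add: beta_def)
qed

definition gammas :: "nat \<Rightarrow> monomial \<Rightarrow> hvec list" where
  "gammas l M = map (\<lambda>i. beta l (Suc i)) (filter (\<lambda>i. M ! i \<noteq> LA) [0..<length M])"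

definition w_good :: "nat \<Rightarrow> monomial \<Rightarrow> hvec \<Rightarrow> hvec" where
  "w_good l M =
     foldl (\<lambda>w \<gamma>. reflection l \<gamma> \<otimes>\<^bsub>BijGroup (hstar l)\<^esub> w) \<one>\<^bsub>BijGroup (hstar l)\<^esub> (gammas l M)"

fun w_pair :: "nat \<Rightarrow> nat \<times> monomial \<Rightarrow> hvec \<Rightarrow> hvec" where
  "w_pair l (0, M) = w_good l M"
| "w_pair l (Suc n, M) =
     Ad_s_inv l (w_pair l (n, M) \<otimes>\<^bsub>BijGroup (hstar l)\<^esub> reflection l (fin_root l 1 2))"

text \<open>
  \<open>w_pair l\<close> is constant on the classes of \<open>translate_rel l\<close>; \<open>w_map\<close> takes the common value.
\<close>

definition w_map :: "nat \<Rightarrow> (nat \<times> monomial) set \<Rightarrow> hvec \<Rightarrow> hvec" where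
  "w_map l X = the_elem (w_pair l ` X)"

end

theory Submission
  imports Defs
begin

text \<open>
  Encode \<open>\<epsilon>\<^sub>j - m\<delta>\<close> (overlined, \<open>1 \<le> j \<le> l\<close>) by the integer \<open>ml + j - 1\<close>. The affine Weyl group
  becomes the group of bijections \<open>u\<close> of the integers with \<open>u(k + l) = u(k) + l\<close> whose displacements
  \<open>u(k) - k\<close> sum to 0 over a period. Number the non-multiples of \<open>l\<close> consecutively: the reflection in
  \<open>\<beta>\<^sub>q\<close> exchanges the label held at 0, the ``hand'', with the label at the \<open>q\<close>-th non-multiple, and
  \<open>s\<close> fixes 0 and moves the \<open>q\<close>-th non-multiple to the next one. Hence a translated good monomial is a
  record of a walk of the hand through all times \<open>q\<close>: at a letter \<open>B\<close> it exchanges its label with the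
  one at location \<open>q\<close>, at a letter \<open>A\<close> it does nothing, and \<open>w\<^sub>M\<close> is the inverse of the final arrangement.

  For a good monomial the hand, on arriving at a location, always holds a smaller label than the one
  found there. So the last letter is \<open>B\<close> iff after the step the hand holds the larger of the two labels;
  reading backwards, the monomial is recovered from the final arrangement. Conversely, run this rule backwards
  from an arbitrary arrangement. The hand's label decreases, by less than \<open>l\<close> in \<open>l - 1\<close> steps, which
  makes the recorded word good. A location class without any \<open>B\<close> would lose \<open>l\<close> in every \<open>l - 1\<close> steps and
  so fall below the hand; thus far back all letters are \<open>B\<close>, where the hand moves by exactly 1 in each
  step and the arrangement is the one belonging to a power of \<open>B\<^sup>-\<^sup>1\<close>.
\<close>

section \<open>Vectors and the invariant form\<close>

lemma hvec_add: "(x, k, d) + (x', k', d') = (\<lambda>i. x i + x' i, k + k', d + d')" for x :: "nat \<Rightarrow> complex"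
  by (simp add: plus_prod_def plus_fun_def)

lemma hvec_diff: "(x, k, d) - (x', k', d') = (\<lambda>i. x i - x' i, k - k', d - d')" for x :: "nat \<Rightarrow> complex"
  by (simp add: minus_prod_def fun_diff_def)

lemma hvec_zero: "(0 :: hvec) = (\<lambda>i. 0, 0, 0)"
  by (simp add: zero_prod_def zero_fun_def)

lemma hvec_scale: "hscale c (x, k, d) = (\<lambda>i. c * x i, c * k, c * d)"
  by (simp add: hscale_def)

lemmas hvec_simps = hvec_add hvec_diff hvec_scale

lemma hvec_sum: "(\<Sum>a\<in>A. (f a, g a, h a)) = (\<lambda>i. \<Sum>a\<in>A. f a i, \<Sum>a\<in>A. g a, \<Sum>a\<in>A. h a)"
  for f :: "'a \<Rightarrow> nat \<Rightarrow> complex" and g h :: "'a \<Rightarrow> complex"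
  by (induction A rule: infinite_finite_induct) (simp_all add: hvec_add hvec_zero plus_fun_def)

lemma delta_eq: "delta = (\<lambda>i. 0, 0, 1)"
  by (simp add: delta_def zero_fun_def)

lemma Lambda0_eq: "Lambda0 = (\<lambda>i. 0, 1, 0)"
  by (simp add: Lambda0_def zero_fun_def)

lemma hform_eq: "hform l (x, k, d) (x', k', d') = (\<Sum>i=1..l. x i * x' i) + k * d' + d * k'"
  by (simp add: hform_def)

lemma hscale_simps [simp]: "hscale 0 v = 0" "hscale 1 v = v" "hscale c 0 = 0"
  by (simp_all add: hscale_def case_prod_beta zero_prod_def zero_fun_def)

lemma hscale_add: "hscale (a + b) v = hscale a v + hscale b v" "hscale a (v + w) = hscale a v + hscale a w"
  "hscale a (v - w) = hscale a v - hscale a w"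
  by (simp_all add: hscale_def case_prod_beta prod_eq_iff fun_eq_iff algebra_simps)

lemma hscale_diff: "hscale (a - b) v = hscale a v - hscale b v"
  using hscale_add(1)[of "a - b" b v] by simp

lemma hscale_hscale: "hscale a (hscale b v) = hscale (a * b) v"
  by (cases v) (simp add: hvec_simps algebra_simps)

lemma hscale_uminus: "hscale (- c) v = - hscale c v"
  by (cases v) (simp add: hvec_simps uminus_prod_def fun_Compl_def)

lemma hform_commute: "hform l v w = hform l w v"
  by (cases v; cases w) (simp add: hform_eq mult.commute)

lemma hform_linear:
  "hform l (v + w) u = hform l v u + hform l w u"
  "hform l (v - w) u = hform l v u - hform l w u"
  "hform l (hscale c v) u = c * hform l v u"
  "hform l u (v + w) = hform l u v + hform l u w"
  "hform l u (v - w) = hform l u v - hform l u w"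
  "hform l u (hscale c v) = c * hform l u v"
  by (simp_all add: hform_def hscale_def case_prod_beta algebra_simps sum.distrib sum_subtractf sum_distrib_left)

lemma eps_bar_eq:
  "eps_bar l i = (\<lambda>j. (if j = i then 1 else 0) - (if j \<in> {1..l} then 1 / of_nat l else 0), 0, 0)"
proof -
  have "(\<Sum>j=1..l. eps j) = (\<lambda>j. if j \<in> {1..l} then 1 else 0, 0, 0)"
    unfolding eps_def hvec_sum by (auto simp: fun_eq_iff)
  then show ?thesis unfolding eps_bar_def eps_def by (auto simp: hvec_simps fun_eq_iff zero_prod_def)
qed

lemma sum_eps_bar: "0 < l \<Longrightarrow> (\<Sum>j=1..l. hscale (x j) (eps_bar l j)) =
   (\<lambda>i. if i \<in> {1..l} then x i - (\<Sum>j=1..l. x j) / of_nat l else 0, 0, 0)"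
proof -
  assume l: "0 < l"
  have "(\<Sum>j=1..l. x j * ((if i = j then 1 else 0) - c)) = (if i \<in> {1..l} then x i else 0) - (\<Sum>j=1..l. x j) * c" for i c
    by (simp add: right_diff_distrib sum_subtractf sum_distrib_right if_distrib[of "(*) _"] cong: if_cong)
  then show ?thesis
    unfolding eps_bar_eq hvec_scale hvec_sum by (auto simp: fun_eq_iff)
qed

section \<open>Affine permutations\<close>

locale affine_rank =
  fixes l :: nat
  assumes two_le_l: "2 \<le> l"
begin

abbreviation L :: int where "L \<equiv> int l"
abbreviation N :: int where "N \<equiv> int l - 1"

text \<open>\<open>loc q\<close> is the \<open>q\<close>-th integer not divisible by \<open>l\<close>, with \<open>loc 1 = 1\<close>.\<close>

definition loc :: "int \<Rightarrow> int" where
  "loc q = q + (q - 1) div N"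

lemma N_pos: "0 < N"
  using two_le_l by simp

text \<open>Euclidean division of \<open>loc q\<close> by \<open>L\<close>: the remainder runs from
  1 to \<open>N\<close> and is never 0.\<close>

lemma loc_decomp: "loc q = (q - 1) mod N + 1 + ((q - 1) div N) * L"
proof -
  have "q - 1 = (q - 1) div N * N + (q - 1) mod N" by (rule div_mult_mod_eq[symmetric])
  then show ?thesis unfolding loc_def by (simp add: algebra_simps)
qed

lemma loc_mod: "loc q mod L = (q - 1) mod N + 1"
proof -
  have "0 \<le> (q - 1) mod N" "(q - 1) mod N < N" using N_pos by simp_all
  then show ?thesis unfolding loc_decomp by simp
qed

lemma loc_div: "loc q div L = (q - 1) div N"
proof -
  have "0 \<le> (q - 1) mod N" "(q - 1) mod N < N" using N_pos by simp_all
  then show ?thesis unfolding loc_decomp by (simp add: div_pos_pos_trivial)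
qed

lemma loc_mod_pos: "0 < loc q mod L"
  using N_pos by (simp add: loc_mod add_nonneg_pos)

lemma loc_shift: "loc (q + m * N) = loc q + m * L"
proof -
  have "(q + m * N - 1) div N = (q - 1 + m * N) div N" by (simp add: algebra_simps)
  also have "\<dots> = (q - 1) div N + m" using N_pos by simp
  finally show ?thesis unfolding loc_def by (simp add: algebra_simps)
qed

lemma loc_add_N: "loc (q + N) = loc q + L"
  using loc_shift[of q 1] by simp

lemma loc_mod_eq_iff: "loc q mod L = loc p mod L \<longleftrightarrow> q mod N = p mod N"
proof -
  have "q mod N = p mod N \<longleftrightarrow> (q - 1) mod N = (p - 1) mod N"
    by (simp add: mod_eq_dvd_iff)
  then show ?thesis by (simp add: loc_mod)
qed

lemma loc_cases:
  obtains m where "k = m * L" | q where "k = loc q"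
proof (cases "k mod L = 0")
  case True
  then have "k = (k div L) * L" using div_mult_mod_eq[of k L] by simp
  then show ?thesis using that(1) by blast
next
  case False
  define q where "q = (k mod L) + (k div L) * N"
  have b: "0 < k mod L" "k mod L - 1 < N" using False two_le_l
    pos_mod_sign[of L k] pos_mod_bound[of L k] by linarith+
  have "(q - 1) div N = (k mod L - 1 + (k div L) * N) div N" by (simp add: q_def algebra_simps)
  also have "\<dots> = k div L" using b by (simp add: div_pos_pos_trivial)
  finally have "loc q = k mod L + (k div L) * L" unfolding loc_def by (simp add: q_def algebra_simps)
  then have "k = loc q" by simp
  then show ?thesis using that(2) by blast
qed

text \<open>The affine transposition of 0 and \<open>loc q\<close>, made to commute with translation
  by \<open>L\<close>. On integer labels it is the reflection in \<beta>_q
  (\<open>rep_reflection\<close>), with \<open>q\<close> ranging over all integers.\<close>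

definition swp :: "int \<Rightarrow> int \<Rightarrow> int" where
  "swp q k = (if k mod L = 0 then k + loc q else if k mod L = loc q mod L then k - loc q else k)"

lemma swp_swp [simp]: "swp q (swp q k) = k"
proof -
  have "k mod L = 0 \<Longrightarrow> (k + loc q) mod L = loc q mod L"
    by (simp add: mod_add_left_eq[symmetric])
  moreover have "k mod L = loc q mod L \<Longrightarrow> (k - loc q) mod L = 0"
    by (simp add: mod_eq_dvd_iff)
  ultimately show ?thesis using loc_mod_pos[of q] by (auto simp: swp_def)
qed

lemma swp_comp [simp]: "swp q \<circ> swp q = id"
  by (simp add: fun_eq_iff)

lemma swp_add_L: "swp q (k + L) = swp q k + L"
  by (simp add: swp_def)

lemma swp_0 [simp]: "swp q 0 = loc q"
  by (simp add: swp_def)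

lemma swp_loc [simp]: "swp q (loc q) = 0"
  using loc_mod_pos[of q] by (simp add: swp_def)

lemma swp_loc_other: "p mod N \<noteq> q mod N \<Longrightarrow> swp q (loc p) = loc p"
  using loc_mod_pos[of p] by (simp add: swp_def loc_mod_eq_iff)

section \<open>Affine bijections and their displacement\<close>

definition affine_bij :: "(int \<Rightarrow> int) \<Rightarrow> bool" where
  "affine_bij f \<longleftrightarrow> bij f \<and> (\<forall>k. f (k + L) = f k + L)"

lemma affine_bijD: "affine_bij f \<Longrightarrow> f (k + L) = f k + L"
  by (simp add: affine_bij_def)

lemma affine_bij_shift: "affine_bij f \<Longrightarrow> f (k + m * L) = f k + m * L"
proof (induction m rule: int_induct[where k = 0])
  case (step1 i)
  then show ?case using affine_bijD[of f "k + i * L"] by (simp add: algebra_simps)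
next
  case (step2 i)
  then show ?case using affine_bijD[of f "k + (i - 1) * L"] by (simp add: algebra_simps)
qed simp

lemma affine_bij_mod: "affine_bij f \<Longrightarrow> f k = f (k mod L) + (k div L) * L"
  using affine_bij_shift[of f "k mod L" "k div L"] by simp

lemma affine_bij_eq_iff: "affine_bij f \<Longrightarrow> f a = f b \<longleftrightarrow> a = b"
  by (auto simp: affine_bij_def bij_is_inj inj_eq)

lemma affine_bij_comp: "affine_bij f \<Longrightarrow> affine_bij g \<Longrightarrow> affine_bij (f \<circ> g)"
  by (simp add: affine_bij_def bij_comp)

lemma affine_bij_swp: "affine_bij (swp q)"
  unfolding affine_bij_def using o_bij[OF swp_comp swp_comp] swp_add_L by blast

lemma affine_bij_inv: "affine_bij f \<Longrightarrow> affine_bij (inv_into UNIV f)"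
  unfolding affine_bij_def by (metis bij_imp_bij_inv bij_inv_eq_iff)

lemma affine_bij_cong: "affine_bij f \<Longrightarrow> f a mod L = f b mod L \<longleftrightarrow> a mod L = b mod L"
proof -
  assume f: "affine_bij f"
  have cong: "a mod L = b mod L \<longleftrightarrow> (\<exists>m. a = b + m * L)" for a b
    unfolding mod_eq_dvd_iff dvd_def by (auto simp: algebra_simps diff_eq_eq)
  have "a mod L = b mod L \<longleftrightarrow> (\<exists>m. a = b + m * L)" by (rule cong)
  also have "\<dots> \<longleftrightarrow> (\<exists>m. f a = f b + m * L)"
    by (simp flip: affine_bij_shift[OF f] add: affine_bij_eq_iff[OF f])
  also have "\<dots> \<longleftrightarrow> f a mod L = f b mod L" by (rule cong[symmetric])
  finally show ?thesis by simp
qed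

definition disp :: "(int \<Rightarrow> int) \<Rightarrow> int" where
  "disp f = (\<Sum>k\<in>{0..<L}. f k - k)"

lemma bij_betw_affine_bij_mod:
  assumes "affine_bij f" shows "bij_betw (\<lambda>k. f k mod L) {0..<L} {0..<L}"
proof -
  have "inj_on (\<lambda>k. f k mod L) {0..<L}"
    by (rule inj_onI) (simp add: affine_bij_cong[OF assms])
  moreover have "(\<lambda>k. f k mod L) ` {0..<L} \<subseteq> {0..<L}" using two_le_l by auto
  ultimately show ?thesis by (simp add: bij_betw_def endo_inj_surj)
qed

text \<open>The displacement of \<open>f\<close> at \<open>g k\<close> depends only on
  \<open>g k mod L\<close>, and \<open>g\<close> permutes the residues, so \<open>f\<close>
  contributes its full displacement.\<close>

lemma disp_comp: assumes "affine_bij f" "affine_bij g" shows "disp (f \<circ> g) = disp f + disp g"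
proof -
  have "f (g k) - g k = f (g k mod L) - g k mod L" for k
    using affine_bij_mod[OF assms(1), of "g k"] div_mult_mod_eq[of "g k" L] by linarith
  then have eq: "(\<Sum>k\<in>{0..<L}. f (g k) - g k) = (\<Sum>k\<in>{0..<L}. f (g k mod L) - g k mod L)" by simp
  also have "\<dots> = disp f" unfolding disp_def
    by (rule sum.reindex_bij_betw[OF bij_betw_affine_bij_mod[OF assms(2)], of "\<lambda>k. f k - k"])
  finally have "disp f + disp g = (\<Sum>k\<in>{0..<L}. (f (g k) - g k) + (g k - k))"
    unfolding sum.distrib by (simp only: disp_def)
  then show ?thesis by (simp add: disp_def)
qed

lemma disp_id [simp]: "disp id = 0"
  by (simp add: disp_def)

text \<open>For an involution, twice the displacement is that of the identity.\<close>

lemma disp_swp [simp]: "disp (swp q) = 0"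
  using disp_comp[OF affine_bij_swp affine_bij_swp, of q q] by simp

definition aff_perms :: "(int \<Rightarrow> int) set" where
  "aff_perms = {f. affine_bij f \<and> disp f = 0}"

lemma aff_perms_id: "id \<in> aff_perms"
  by (simp add: aff_perms_def affine_bij_def)

lemma aff_perms_comp: "f \<in> aff_perms \<Longrightarrow> g \<in> aff_perms \<Longrightarrow> f \<circ> g \<in> aff_perms"
  by (simp add: aff_perms_def affine_bij_comp disp_comp)

lemma aff_perms_swp: "swp q \<in> aff_perms"
  by (simp add: aff_perms_def affine_bij_swp)

lemma aff_perms_inv: "f \<in> aff_perms \<Longrightarrow> inv_into UNIV f \<in> aff_perms"
proof -
  assume "f \<in> aff_perms"
  then have f: "affine_bij f" "disp f = 0" by (simp_all add: aff_perms_def)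
  have "f \<circ> inv_into UNIV f = id" using f(1) by (metis affine_bij_def bij_is_surj surj_iff)
  then have "disp (inv_into UNIV f) = 0"
    using disp_comp[OF f(1) affine_bij_inv[OF f(1)]] f(2) by simp
  then show ?thesis by (simp add: aff_perms_def affine_bij_inv[OF f(1)])
qed

text \<open>
  Arrangements map positions to labels and are thus inverse to the action of the group elements:
  multiplying \<open>w\<close> by a reflection on the left composes the arrangement with \<open>swp\<close> on the right.
\<close>

primrec arrange :: "(int \<Rightarrow> int) \<Rightarrow> int \<Rightarrow> monomial \<Rightarrow> int \<Rightarrow> int" where
  "arrange f p [] = f"
| "arrange f p (c # M) = arrange (if c = LB then f \<circ> swp p else f) (p + 1) M"

lemma arrange_append: "arrange f p (M @ M') = arrange (arrange f p M) (p + int (length M)) M'"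
  by (induction M arbitrary: f p) (auto simp: algebra_simps)

lemma arrange_aff_perms: "f \<in> aff_perms \<Longrightarrow> arrange f p M \<in> aff_perms"
  by (induction M arbitrary: f p) (auto simp: aff_perms_comp aff_perms_swp)

lemma arrange_comp: "arrange (g \<circ> f) p M = g \<circ> arrange f p M"
  by (induction M arbitrary: f p) (auto simp: comp_assoc)

text \<open>
  The arrangement at time \<open>1 - n\<close> of the walk that uses only \<open>B\<close> and is at the identity at time 1;
  it belongs to \<open>B\<^sup>-\<^sup>n\<close>.
\<close>

primrec allB :: "nat \<Rightarrow> int \<Rightarrow> int" where
  "allB 0 = id"
| "allB (Suc n) = allB n \<circ> swp (- int n)"

declare allB.simps [simp del]

lemma allB_aff_perms: "allB n \<in> aff_perms"
proof (induction n)
  case 0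
  show ?case unfolding allB.simps by (rule aff_perms_id)
next
  case (Suc n)
  then show ?case unfolding allB.simps by (rule aff_perms_comp[OF _ aff_perms_swp])
qed

lemma allB_Suc_swp: "allB (Suc n) \<circ> swp (- int n) = allB n"
  unfolding allB.simps by (simp add: comp_assoc)

text \<open>Running \<open>k\<close> exchanges forward undoes the last \<open>k\<close> backward
  steps: the cancellation of \<open>B^-1\<close> against \<open>B\<close> on arrangements.\<close>

lemma allB_replicate: "arrange (allB (n + k)) (1 - int (n + k)) (replicate k LB) = allB n"
proof (induction k)
  case (Suc k)
  have "1 - int (n + Suc k) = - int (n + k)" by simp
  then show ?case using Suc allB_Suc_swp[of "n + k"] by (simp add: algebra_simps)
qed simp

text \<open>One more step back changes only the hand's class and the locations with
  \<open>N dvd q + int n\<close>; exactly there the floor in the formula jumps. The hand drops by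
  one because \<open>-1 div N = -1\<close>.\<close>

lemma allB_0: "allB n 0 = - int n"
  and allB_loc: "allB n (loc q) = q + (q - 1 + int n) div N"
proof (induction n arbitrary: q)
  case 0
  {case 1 then show ?case by (simp add: allB.simps)}
  {case 2 then show ?case by (simp add: loc_def allB.simps)}
next
  case (Suc n)
  {case 1 show ?case using Suc(2)[of "- int n"] N_pos by (simp add: allB.simps div_eq_minus1)}
  {case 2
    show ?case
    proof (cases "N dvd q + int n")
      case True
      then obtain m where m: "q = - int n + m * N"
        by (auto elim!: dvdE simp: algebra_simps eq_diff_eq)
      have "allB (Suc n) (loc q) = allB n (swp (- int n) (loc (- int n) + m * L))"
        unfolding m loc_shift by (simp add: allB.simps)
      also have "\<dots> = allB n (0 + m * L)"
        by (simp only: affine_bij_shift[OF affine_bij_swp] swp_loc)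
      also have "\<dots> = - int n + m * L"
        using affine_bij_shift[of "allB n" 0 m] allB_aff_perms[of n] Suc(1) by (simp add: aff_perms_def)
      also have "\<dots> = q + m" using m by (simp add: algebra_simps)
      also have "m = (m * N) div N" using N_pos by simp
      also have "m * N = q - 1 + int (Suc n)" using m by simp
      finally show ?thesis .
    next
      case False
      let ?a = "q + int n"
      have "?a mod N \<noteq> 0"
        using False by (simp add: dvd_eq_mod_eq_0)
      then have b: "0 \<le> ?a mod N - 1" "?a mod N - 1 < N"
        using N_pos pos_mod_sign[of N ?a] pos_mod_bound[of N ?a] by linarith+
      have "?a - 1 = ?a mod N - 1 + ?a div N * N"
        using div_mult_mod_eq[of ?a N] by linarith
      then have "(?a - 1) div N = (?a mod N - 1 + ?a div N * N) div N" by (rule arg_cong)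
      also have "\<dots> = ?a div N" using b by simp
      moreover have "q mod N \<noteq> (- int n) mod N" using False by (simp add: mod_eq_dvd_iff)
      ultimately show ?thesis using Suc(2)[of q] swp_loc_other[of q "- int n"] by (simp add: algebra_simps allB.simps)
    qed}
qed

section \<open>Walks of the hand\<close>

text \<open>\<open>C p\<close> says that the letter at time \<open>p\<close> is \<open>B\<close>; \<open>F p\<close> is the arrangement before that step.\<close>

definition traj :: "(int \<Rightarrow> bool) \<Rightarrow> (int \<Rightarrow> int \<Rightarrow> int) \<Rightarrow> bool" where
  "traj C F \<longleftrightarrow> (\<forall>p. F p \<in> aff_perms \<and> F (p + 1) = (if C p then F p \<circ> swp p else F p))"

lemma traj_aff_perms: "traj C F \<Longrightarrow> F p \<in> aff_perms"
  by (simp add: traj_def)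

lemma traj_affine_bij: "traj C F \<Longrightarrow> affine_bij (F p)"
  using traj_aff_perms by (simp add: aff_perms_def)

lemma traj_step: "traj C F \<Longrightarrow> F (p + 1) = (if C p then F p \<circ> swp p else F p)"
  by (simp add: traj_def)

lemma traj_hand: "traj C F \<Longrightarrow> F (p + 1) 0 = (if C p then F p (loc p) else F p 0)"
  by (simp add: traj_step)

lemma traj_loc: "traj C F \<Longrightarrow> F (p + 1) (loc p) = (if C p then F p 0 else F p (loc p))"
  by (simp add: traj_step)

lemma traj_other: "traj C F \<Longrightarrow> q mod N \<noteq> p mod N \<Longrightarrow> F (p + 1) (loc q) = F p (loc q)"
  by (simp add: traj_step swp_loc_other)

text \<open>Location \<open>q\<close> is less than one round ahead of \<open>p\<close>, so its class
  modulo \<open>N\<close> is not visited from time \<open>p\<close> to \<open>q - 1\<close>.\<close>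

lemma traj_unchanged:
  assumes "traj C F" "p \<le> p'" "p' \<le> q" "q < p + N"
  shows "F p' (loc q) = F p (loc q)"
  using assms(2,3)
proof (induction p' rule: int_ge_induct)
  case (step i)
  have "\<not> N dvd q - i"
    using step assms(4) zdvd_not_zless[of "q - i" N] by simp
  then show ?case
    using step traj_other[OF assms(1), of q i] by (simp add: mod_eq_dvd_iff)
qed simp

text \<open>The class of \<open>p\<close> is next visited \<open>N\<close> steps later, one period
  further on. Until then the label left by step \<open>p\<close> stays, and the change of period
  adds \<open>L\<close>.\<close>

lemma traj_next:
  assumes "traj C F"
  shows "F (p + N) (loc (p + N)) = (if C p then F p 0 else F p (loc p)) + L"
proof -
  have "F p' (loc p) = F (p + 1) (loc p)" if "p + 1 \<le> p'" "p' \<le> p + N" for p'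
    using that
  proof (induction p' rule: int_ge_induct)
    case (step i)
    have "\<not> N dvd i - p"
      using step zdvd_not_zless[of "i - p" N] by simp
    then have "p mod N \<noteq> i mod N" by (metis mod_eq_dvd_iff)
    then show ?case
      using step traj_other[OF assms(1), of p i] by simp
  qed simp
  from this[of "p + N"] have "F (p + N) (loc p) = F (p + 1) (loc p)" using N_pos by simp
  then show ?thesis
    using affine_bijD[OF traj_affine_bij[OF assms]] traj_loc[OF assms] by (simp add: loc_add_N)
qed

text \<open>A step either keeps the hand's label or trades it for the larger one found at the
  location.\<close>

lemma traj_mono:
  assumes t: "traj C F" and pos: "\<And>q. q < p' \<Longrightarrow> F q 0 < F q (loc q)" and "p \<le> p'"
  shows "F p 0 \<le> F p' 0"
  using assms(3) pos
proof (induction p' rule: int_ge_induct)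
  case (step i)
  then have "F p 0 \<le> F i 0" by simp
  also have "\<dots> \<le> F (i + 1) 0" using step(3)[of i] traj_hand[OF t, of i] by simp
  finally show ?case .
qed simp

text \<open>
  If the hand last changed at time \<open>i \<ge> p - N\<close>, it picked up the label that it had put down at time \<open>i - N\<close>,
  since \<open>C\<close> is closed under subtraction of \<open>N\<close>. So it holds less than its label at time \<open>p - N\<close> plus \<open>L\<close>,
  which in turn is at most the label at location \<open>p\<close>.
\<close>

lemma traj_pos_next:
  assumes t: "traj C F" and closed: "\<And>p. C (p + N) \<Longrightarrow> C p"
    and pos: "\<And>q. q < p \<Longrightarrow> F q 0 < F q (loc q)"
  shows "F p 0 < F p (loc p)"
proof -
  have "F p' 0 < F (p - N) 0 + L" if "p - N \<le> p'" "p' \<le> p" for p'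
    using that
  proof (induction p' rule: int_ge_induct)
    case base
    show ?case using two_le_l by simp
  next
    case (step i)
    show ?case
    proof (cases "C i")
      case True
      then have C: "C (i - N)" using closed[of "i - N"] by simp
      have "F (i + 1) 0 = F (i - N) 0 + L"
        using traj_hand[OF t, of i] traj_next[OF t, of "i - N"] True C by simp
      moreover have "F (i - N) 0 < F (i - N + 1) 0"
        using traj_hand[OF t, of "i - N"] C pos[of "i - N"] step N_pos by simp
      moreover have "F (i - N + 1) 0 \<le> F (p - N) 0"
        using step N_pos by (intro traj_mono[OF t pos]) auto
      ultimately show ?thesis by simp
    qed (use step traj_hand[OF t, of i] in simp)
  qed
  from this[of p] have "F p 0 < F (p - N) 0 + L" using N_pos by simp
  also have "\<dots> \<le> F p (loc p)"
    using traj_next[OF t, of "p - N"] pos[of "p - N"] N_pos by simp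
  finally show ?thesis .
qed

text \<open>\<open>traj_pos_next\<close> needs the inequality on the whole past, so the upward
  induction from \<open>a\<close> carries it for all times below \<open>b\<close>.\<close>

lemma traj_pos:
  assumes t: "traj C F" and closed: "\<And>p. C (p + N) \<Longrightarrow> C p"
    and init: "\<And>p. p < a \<Longrightarrow> F p 0 < F p (loc p)"
  shows "F p 0 < F p (loc p)"
proof -
  have "\<forall>p<b. F p 0 < F p (loc p)" if "a \<le> b" for b
    using that
  proof (induction b rule: int_ge_induct)
    case (step i)
    then show ?case using traj_pos_next[OF t closed, of i] by (metis zless_add1_eq)
  qed (use init in blast)
  from this[of "max a (p + 1)"] show ?thesis by simp
qed

text \<open>Before the step the hand holds the smaller label, so an exchange shows afterwards in the
  order of the two labels, and exchanging again undoes it.\<close>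

lemma traj_reverse:
  assumes "traj C F" "F p 0 < F p (loc p)"
  shows "C p \<longleftrightarrow> F (p + 1) (loc p) < F (p + 1) 0"
    and "F p = (if C p then F (p + 1) \<circ> swp p else F (p + 1))"
  using assms by (auto simp: traj_step comp_assoc)

text \<open>Backward determinism: by \<open>traj_reverse\<close> the arrangement after a step
  determines the letter and the arrangement before it.\<close>

lemma traj_unique:
  assumes t: "traj C F" "traj C' F'"
    and pos: "\<And>p. F p 0 < F p (loc p)" "\<And>p. F' p 0 < F' p (loc p)"
    and eq: "F b = F' b" and "p < b"
  shows "C p \<longleftrightarrow> C' p"
proof -
  have rev: "F p = F' p \<and> (C p \<longleftrightarrow> C' p)" if "F (p + 1) = F' (p + 1)" for p
    using traj_reverse[OF t(1) pos(1), of p] traj_reverse[OF t(2) pos(2), of p] that by simp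
  have "F p = F' p" if "p \<le> b" for p
    using that
  proof (induction p rule: int_le_induct)
    case (step i)
    then show ?case using rev[of "i - 1"] by simp
  qed (rule eq)
  then show ?thesis using rev[of p] \<open>p < b\<close> by simp
qed

text \<open>The walk of \<open>B^-n M\<close> over all integer times: letters \<open>B\<close>
  before time \<open>1 - int n\<close>, then the letters of \<open>M\<close>, then \<open>A\<close>
  for ever. At the seam both branches give \<open>allB n\<close>.\<close>

definition word_traj :: "nat \<Rightarrow> monomial \<Rightarrow> int \<Rightarrow> int \<Rightarrow> int" where
  "word_traj n M p = (if p \<le> 1 - int n then allB (nat (1 - p))
     else arrange (allB n) (1 - int n) (take (nat (p - (1 - int n))) M))"

definition word_set :: "nat \<Rightarrow> monomial \<Rightarrow> int \<Rightarrow> bool" where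
  "word_set n M p \<longleftrightarrow> p < 1 - int n \<or>
     (nat (p - (1 - int n)) < length M \<and> M ! nat (p - (1 - int n)) = LB)"

lemma traj_word: "traj (word_set n M) (word_traj n M)"
  unfolding traj_def
proof (intro allI conjI)
  fix p
  show "word_traj n M p \<in> aff_perms"
    by (simp add: word_traj_def allB_aff_perms arrange_aff_perms)
  let ?a = "1 - int n"
  show "word_traj n M (p + 1) = (if word_set n M p then word_traj n M p \<circ> swp p else word_traj n M p)"
  proof (cases "p < ?a")
    case True
    define m where "m = nat (- p)"
    have m: "p = - int m" "nat (1 - p) = Suc m" "nat (1 - (p + 1)) = m"
      using True by (auto simp: m_def)
    show ?thesis using True allB_Suc_swp[of m]
      unfolding word_traj_def word_set_def m(2,3) by (simp add: m(1))
  next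
    case False
    define k where "k = nat (p - ?a)"
    have k: "p = ?a + int k" using False by (simp add: k_def)
    have eq: "word_traj n M (?a + int j) = arrange (allB n) ?a (take j M)" for j
      by (auto simp: word_traj_def)
    have k1: "p + 1 = ?a + int (Suc k)" using k by simp
    have set: "word_set n M p \<longleftrightarrow> k < length M \<and> M ! k = LB"
      using False by (simp add: word_set_def k_def)
    show ?thesis unfolding k1 eq set
      unfolding k eq
      by (cases "k < length M") (auto simp: take_Suc_conv_app_nth arrange_append)
  qed
qed

lemma word_traj_final:
  "int (length M) \<le> p - (1 - int n) \<Longrightarrow> word_traj n M p = arrange (allB n) (1 - int n) M"
  by (cases "p = 1 - int n") (auto simp: word_traj_def)

text \<open>Goodness in contrapositive form. It extends to all times because every letter before the
  word is \<open>B\<close> and every letter after it is \<open>A\<close>.\<close>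

lemma word_set_closed:
  assumes "good l M" "word_set n M (p + N)"
  shows "word_set n M p"
proof (cases "p < 1 - int n")
  case False
  define k where "k = nat (p - (1 - int n))"
  have k: "nat (p + N - (1 - int n)) = k + (l - 1)" 
    using False two_le_l by (simp add: k_def)
  have *: "k + (l - 1) < length M" "M ! (k + (l - 1)) = LB"
    using assms(2) False N_pos unfolding word_set_def k by auto
  then have "M ! k \<noteq> LA" using assms(1) unfolding good_def by auto
  then have "M ! k = LB" by (cases "M ! k") auto
  then show ?thesis using * by (simp add: word_set_def k_def)
qed (simp add: word_set_def)

text \<open>Before the word starts, the hand holds \<open>p - 1\<close> at time \<open>p\<close> and
  finds \<open>p\<close> at the location; \<open>traj_pos\<close> carries the inequality
  forward.\<close>

lemma word_traj_pos:
  assumes "good l M"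
  shows "word_traj n M p 0 < word_traj n M p (loc p)"
proof (rule traj_pos[OF traj_word word_set_closed[OF assms], where a = "1 - int n"])
  fix p :: int assume "p < 1 - int n"
  then have "word_traj n M p = allB (nat (1 - p))" "int (nat (1 - p)) = 1 - p" 
    by (auto simp: word_traj_def)
  then show "word_traj n M p 0 < word_traj n M p (loc p)"
    by (simp add: allB_0 allB_loc)
qed

text \<open>The last \<open>B\<close> fixes the length of a word; trailing letters \<open>A\<close>
  would be invisible in \<open>word_set\<close>.\<close>

lemma word_set_inj:
  assumes "word_set n M = word_set n M'" "M = [] \<or> last M = LB" "M' = [] \<or> last M' = LB"
  shows "M = M'"
proof -
  have iff: "k < length M \<and> M ! k = LB \<longleftrightarrow> k < length M' \<and> M' ! k = LB" for k
    using fun_cong[OF assms(1), of "1 - int n + int k"] by (simp add: word_set_def)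
  have le: "length X \<le> length Y" 
    if "\<And>k. k < length X \<and> X ! k = LB \<Longrightarrow> k < length Y" "X = [] \<or> last X = LB" for X Y
    using that(1)[of "length X - 1"] that(2) by (cases "X = []") (auto simp: last_conv_nth)
  have len: "length M = length M'"
    using le[of M M'] le[of M' M] iff assms(2,3) by force
  show ?thesis
  proof (rule nth_equalityI[OF len])
    fix k assume "k < length M"
    then show "M ! k = M' ! k" using iff[of k] len by (cases "M ! k"; cases "M' ! k") auto
  qed
qed

lemma arrange_allB_inj:
  assumes "M \<in> good_monomials l" "M' \<in> good_monomials l"
    and "arrange (allB n) (1 - int n) M = arrange (allB n) (1 - int n) M'"
  shows "M = M'"
proof -
  have good: "good l M" "good l M'" and last: "M = [] \<or> last M = LB" "M' = [] \<or> last M' = LB"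
    using assms(1,2) by (auto simp: good_monomials_def)
  have "word_set n M p \<longleftrightarrow> word_set n M' p" for p
  proof -
    \<comment> \<open>A time after \<open>p\<close> at which both words have been read to the end,
      so both walks show their final arrangements.\<close>
    define b where "b = max (p + 1) (1 - int n + int (length M) + int (length M'))"
    have "word_traj n M b = word_traj n M' b"
      using assms(3) word_traj_final[of M b n] word_traj_final[of M' b n] by (simp add: b_def)
    then show ?thesis
      by (rule traj_unique[OF traj_word traj_word word_traj_pos[OF good(1)] word_traj_pos[OF good(2)]])
        (simp add: b_def)
  qed
  then show ?thesis using word_set_inj last by blast
qed

section \<open>Running the walk backwards\<close>

text \<open>The displacement of \<open>f\<close> is periodic, hence bounded below by some
  \<open>K\<close>, while \<open>q \<le> loc q\<close> for positive \<open>q\<close>; so labels far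
  out exceed any bound.\<close>

lemma eventually_above:
  assumes "affine_bij f"
  obtains b where "\<And>q. b \<le> q \<Longrightarrow> f 0 < f (loc q)"
proof -
  define K where "K = Min ((\<lambda>k. f k - k) ` {0..<L})"
  have K: "f k \<ge> k + K" for k
  proof -
    have "f k - k = f (k mod L) - k mod L"
      using affine_bij_mod[OF assms, of k] div_mult_mod_eq[of k L] by linarith
    moreover have "K \<le> f (k mod L) - k mod L"
      unfolding K_def using two_le_l by (intro Min_le) auto
    ultimately show ?thesis by linarith
  qed
  have "f 0 < f (loc q)" if "max 1 (f 0 - K + 1) \<le> q" for q
  proof -
    have "0 \<le> (q - 1) div N" using that N_pos by (simp add: pos_imp_zdiv_nonneg_iff)
    then have "q \<le> loc q" by (simp add: loc_def)
    then show ?thesis using that K[of "loc q"] by linarith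
  qed
  then show ?thesis using that by blast
qed

text \<open>\<open>rewind f b k\<close> is the arrangement \<open>k\<close> steps before time
  \<open>b\<close>. Each step back exchanges unless the hand already holds the smaller label,
  following \<open>traj_reverse\<close>.\<close>

primrec rewind :: "(int \<Rightarrow> int) \<Rightarrow> int \<Rightarrow> nat \<Rightarrow> int \<Rightarrow> int" where
  "rewind f b 0 = f"
| "rewind f b (Suc k) = (if rewind f b k 0 < rewind f b k (loc (b - 1 - int k)) then rewind f b k
     else rewind f b k \<circ> swp (b - 1 - int k))"

declare rewind.simps [simp del]

lemma rewind_aff_perms: "f \<in> aff_perms \<Longrightarrow> rewind f b k \<in> aff_perms"
  by (induction k) (auto simp only: rewind.simps aff_perms_comp aff_perms_swp split: if_splits)

lemma rewind_traj:
  assumes f: "f \<in> aff_perms" and b: "\<And>q. b \<le> q \<Longrightarrow> f 0 < f (loc q)"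
  obtains C F where "traj C F" "\<And>p. b \<le> p \<Longrightarrow> F p = f" "\<And>p. F p 0 < F p (loc p)"
proof -
  define F where "F p = rewind f b (nat (b - p))" for p
  define C where "C p \<longleftrightarrow> p < b \<and> \<not> F (p + 1) 0 < F (p + 1) (loc p)" for p
  have F: "F p \<in> aff_perms" for p unfolding F_def by (rule rewind_aff_perms[OF f])
  have step: "F p = (if C p then F (p + 1) \<circ> swp p else F (p + 1))" if "p < b" for p
  proof -
    define k where "k = nat (b - (p + 1))"
    have k: "nat (b - p) = Suc k" "b - 1 - int k = p" using that by (auto simp: k_def)
    show ?thesis using that unfolding C_def F_def k k_def[symmetric] rewind.simps by auto
  qed
  have final: "F p = f" if "b \<le> p" for p
    using that by (simp add: F_def rewind.simps)
  have "traj C F" unfolding traj_def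
  proof (intro allI conjI F)
    fix p
    show "F (p + 1) = (if C p then F p \<circ> swp p else F p)"
      using step[of p] final[of p] final[of "p + 1"]
      by (cases "p < b") (auto simp: comp_assoc, auto simp: C_def)
  qed
  moreover have "F p 0 < F p (loc p)" for p
  proof (cases "p < b")
    case True
    \<comment> \<open>Labels at distinct positions differ, so undoing an exchange leaves the hand
      strictly smaller.\<close>
    have "F (p + 1) 0 \<noteq> F (p + 1) (loc p)"
      using affine_bij_eq_iff[of "F (p + 1)" 0 "loc p"] F[of "p + 1"] loc_mod_pos[of p] by (auto simp: aff_perms_def)
    then show ?thesis using step[OF True] by (auto simp: C_def True)
  qed (use final b in simp)
  ultimately show ?thesis using that final by blast
qed

text \<open>Going back one step does not raise the hand and leaves all other location classes as
  they are. In the class of the step itself, locations further ahead carry its label plus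
  nonnegative multiples of \<open>L\<close>.\<close>

lemma traj_hand_minimal:
  assumes t: "traj C F" and pos: "\<And>p. F p 0 < F p (loc p)"
    and final: "\<And>p q. b \<le> p \<Longrightarrow> p \<le> q \<Longrightarrow> F p 0 < F p (loc q)"
    and "p \<le> q"
  shows "F p 0 < F p (loc q)"
proof (cases "b \<le> p")
  case False
  then have "p \<le> b" by simp
  then have "\<forall>q\<ge>p. F p 0 < F p (loc q)"
  proof (induction p rule: int_le_induct)
    case (step i)
    let ?p = "i - 1"
    have le: "F ?p 0 \<le> F i 0" using traj_hand[OF t, of ?p] pos[of ?p] by simp
    show ?case
    proof (intro allI impI)
      fix q assume q: "?p \<le> q"
      show "F ?p 0 < F ?p (loc q)"
      proof (cases "q mod N = ?p mod N")
        case True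
        then obtain m where m: "q = ?p + m * N"
          unfolding mod_eq_dvd_iff dvd_def by (auto simp: algebra_simps diff_eq_eq)
        have "0 \<le> m * N" using m q by linarith
        then have "0 \<le> m" using N_pos by (simp add: zero_le_mult_iff)
        then have "0 \<le> m * L" by simp
        then show ?thesis
          using pos[of ?p] unfolding m loc_shift affine_bij_shift[OF traj_affine_bij[OF t]] by linarith
      next
        case False
        then have "q \<noteq> ?p" by auto
        then have "F i 0 < F i (loc q)" using step q by simp
        then show ?thesis using le traj_other[OF t False] by simp
      qed
    qed
  qed (use final in blast)
  then show ?thesis using \<open>p \<le> q\<close> by blast
qed (use assms in blast)

text \<open>Backward induction from time \<open>p + N\<close>. A label laid down at time
  \<open>i\<close> of the round reappears, raised by \<open>L\<close>, at location
  \<open>i + N\<close>, which is not yet passed at time \<open>p + N\<close>, so it exceeds the hand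
  there.\<close>

lemma traj_hand_bound:
  assumes t: "traj C F" and min: "\<And>p q. p \<le> q \<Longrightarrow> F p 0 < F p (loc q)"
  shows "F (p + N) 0 < F p 0 + L"
proof -
  have "F (p + N) 0 < F p' 0 + L" if "p' \<le> p + N" "p \<le> p'" for p'
    using that
  proof (induction p' rule: int_le_induct)
    case (step i)
    let ?p = "i - 1"
    show ?case
    proof (cases "C ?p")
      case True
      have "F (p + N) 0 < F (p + N) (loc (?p + N))" using step by (intro min) simp
      also have "\<dots> = F (?p + N) (loc (?p + N))"
        using step by (intro traj_unchanged[OF t, symmetric]) auto
      also have "\<dots> = F ?p 0 + L" using traj_next[OF t, of ?p] True by simp
      finally show ?thesis .
    qed (use step traj_hand[OF t, of ?p] in simp)
  qed (use two_le_l in simp)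
  then show ?thesis using N_pos by simp
qed

text \<open>With \<open>A\<close> at \<open>p\<close> and \<open>B\<close> at \<open>p + N\<close>
  the hand would pick up the label it had passed over, raised by \<open>L\<close>. That label was
  above the hand, which would thus gain more than \<open>L\<close> in \<open>N\<close>
  steps.\<close>

lemma traj_closed:
  assumes t: "traj C F" and min: "\<And>p q. p \<le> q \<Longrightarrow> F p 0 < F p (loc q)"
    and "C (p + N)"
  shows "C p"
proof (rule ccontr)
  assume "\<not> C p"
  then have "F (p + 1 + N) 0 = F p (loc p) + L" "F (p + 1) 0 = F p 0"
    using traj_hand[OF t, of "p + N"] traj_hand[OF t, of p] traj_next[OF t, of p] \<open>C (p + N)\<close>
    by (simp_all add: algebra_simps)
  then show False using traj_hand_bound[OF t min, of "p + 1"] min[of p p] by simp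
qed

lemma traj_closed_mult:
  assumes t: "traj C F" and min: "\<And>p q. p \<le> q \<Longrightarrow> F p 0 < F p (loc q)"
  shows "C p \<Longrightarrow> C (p - int k * N)"
proof (induction k)
  case (Suc k)
  then show ?case using traj_closed[OF t min, of "p - int (Suc k) * N"] by (simp add: algebra_simps)
qed simp

text \<open>Without any \<open>B\<close> the label met in this class drops by \<open>L\<close> per
  round into the past, the hand by less. The gap shrinks by at least one each round, although it
  must stay positive.\<close>

lemma traj_active:
  assumes t: "traj C F" and min: "\<And>p q. p \<le> q \<Longrightarrow> F p 0 < F p (loc q)"
  shows "\<exists>k. C (q - int k * N)"
proof (rule ccontr)
  assume "\<nexists>k. C (q - int k * N)"
  then have no: "\<not> C (q - int k * N)" for k by blast
  define P where "P k = q - int k * N" for k :: nat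
  have P: "P k = P (Suc k) + N" for k by (simp add: P_def algebra_simps)
  have "F (P k) (loc (P k)) - F (P k) 0 \<le> F q (loc q) - F q 0 - int k" for k
  proof (induction k)
    case (Suc k)
    have "F (P k) (loc (P k)) = F (P (Suc k)) (loc (P (Suc k))) + L"
      using traj_next[OF t, of "P (Suc k)"] no[of "Suc k"] unfolding P[of k] by (simp add: P_def)
    moreover have "F (P k) 0 < F (P (Suc k)) 0 + L"
      using traj_hand_bound[OF t min, of "P (Suc k)"] unfolding P[of k] by simp
    ultimately show ?case using Suc by simp
  qed (simp add: P_def)
  \<comment> \<open>After as many rounds as the initial gap, the bound leaves a gap of at most
    0.\<close>
  from this[of "nat (F q (loc q) - F q 0)"] show False
    using min[of "P (nat (F q (loc q) - F q 0))" "P (nat (F q (loc q) - F q 0))"] min[of q q] by simp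
qed

text \<open>Each of the finitely many classes modulo \<open>N\<close> has a \<open>B\<close>, and
  from there into the past only \<open>B\<close>. The largest number of rounds needed serves all
  classes at once.\<close>

lemma traj_eventually_all:
  assumes t: "traj C F" and min: "\<And>p q. p \<le> q \<Longrightarrow> F p 0 < F p (loc q)"
  obtains a where "\<And>p. p < a \<Longrightarrow> C p"
proof -
  obtain kf where kf: "\<And>q. C (q - int (kf q) * N)"
    using traj_active[OF t min] by metis
  define K where "K = Max (kf ` {0..<N})"
  have "C p" if "p < - int K * N" for p
  proof -
    define r where "r = p mod N"
    have "r \<in> {0..<N}" using N_pos by (simp add: r_def)
    then have K: "kf r \<le> K" unfolding K_def by (intro Max_ge) auto
    have p: "p = r + p div N * N" unfolding r_def by (simp only: mod_mult_div_eq mult.commute mod_div_mult_eq)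
    have "p div N \<le> (- int K * N) div N" using that N_pos by (intro zdiv_mono1) auto
    then have "p div N \<le> - int K" using nonzero_mult_div_cancel_right[of N "- int K"] N_pos by linarith
    define j where "j = nat (- (p div N) - int (kf r))"
    have "p div N = - int (kf r) - int j" using \<open>p div N \<le> - int K\<close> K by (simp add: j_def)
    from p[unfolded this] have "p = r - int (kf r) * N - int j * N" by (simp add: algebra_simps)
    then show ?thesis using traj_closed_mult[OF t min kf, of r j] by simp
  qed
  then show ?thesis using that by blast
qed

text \<open>With \<open>B\<close> throughout, the hand meets its own label of time \<open>p\<close>,
  raised by \<open>L\<close>, after \<open>N\<close> steps and so gains \<open>L\<close> in
  \<open>L\<close> steps. Each step gains at least 1, hence exactly 1.\<close>

lemma traj_hand_Suc:
  assumes t: "traj C F" and pos: "\<And>p. F p 0 < F p (loc p)" and all: "\<And>p. p < a \<Longrightarrow> C p"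
    and p: "p + L \<le> a"
  shows "F (p + 1) 0 = F p 0 + 1"
proof -
  have less: "F p 0 + 1 \<le> F (p + 1) 0" if "p < a" for p
    using traj_hand[OF t, of p] all[OF that] pos[of p] by simp
  have "F (p + 1) 0 + (p' - (p + 1)) \<le> F p' 0" if "p + 1 \<le> p'" "p' \<le> a" for p'
    using that
  proof (induction p' rule: int_ge_induct)
    case (step i)
    then show ?case using less[of i] by simp
  qed simp
  from this[of "p + L"] have "F (p + 1) 0 + N \<le> F (p + L) 0" using p two_le_l by simp
  also have "\<dots> = F p 0 + L"
    using traj_next[OF t, of p] traj_hand[OF t, of "p + N"] all[of p] all[of "p + N"] p two_le_l by simp
  finally show ?thesis using less[of p] p two_le_l by simp
qed

text \<open>0 and any \<open>N\<close> consecutive locations represent all residues modulo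
  \<open>L\<close>.\<close>

lemma affine_bij_eqI:
  assumes "affine_bij f" "\<And>k. g (k + L) = g k + L" "f 0 = g 0" "\<And>q. a \<le> q \<Longrightarrow> q < a + N \<Longrightarrow> f (loc q) = g (loc q)"
  shows "f = g"
proof
  have g: "g (k + m * L) = g k + m * L" for k m
  proof (induction m rule: int_induct[where k = 0])
    case (step1 i)
    then show ?case using assms(2)[of "k + i * L"] by (simp add: algebra_simps)
  next
    case (step2 i)
    then show ?case using assms(2)[of "k + (i - 1) * L"] by (simp add: algebra_simps)
  qed simp
  fix k
  show "f k = g k"
  proof (cases k rule: loc_cases)
    case (1 m)
    then show ?thesis using affine_bij_shift[OF assms(1), of 0 m] g[of 0 m] assms(3) by simp
  next
    case (2 q)
    define r where "r = a + (q - a) mod N"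
    have "q = r + (q - a) div N * N" using div_mult_mod_eq[of "q - a" N] unfolding r_def by linarith
    then have k: "k = loc r + (q - a) div N * L" using 2 loc_shift by metis
    have "f (loc r) = g (loc r)" using N_pos by (intro assms(4)) (auto simp: r_def)
    then show ?thesis unfolding k g affine_bij_shift[OF assms(1)] by simp
  qed
qed

text \<open>In the all-\<open>B\<close> past the hand moves by 1 per step, so the arrangement is
  \<open>allB n\<close> up to a constant \<open>e\<close>. The constant adds \<open>L * e\<close> to
  the displacement, which is 0 for both. The margin \<open>2 * L\<close> keeps a whole round within
  reach of \<open>traj_hand_Suc\<close>.\<close>

lemma traj_start:
  assumes t: "traj C F" and pos: "\<And>p. F p 0 < F p (loc p)" and all: "\<And>p. p < a \<Longrightarrow> C p"
    and n: "1 - int n + 2 * L \<le> a"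
  shows "F (1 - int n) = allB n"
proof -
  let ?a = "1 - int n"
  define e where "e = F ?a 0 + int n"
  have hand: "F p 0 = p - 1 + e" if "?a \<le> p" "p \<le> ?a + N" for p
    using that
  proof (induction p rule: int_ge_induct)
    case (step i)
    then show ?case using traj_hand_Suc[OF t pos, of a i] all n by simp
  qed (simp add: e_def)
  have eq: "F ?a = (\<lambda>k. allB n k + e)"
  proof (rule affine_bij_eqI[OF traj_affine_bij[OF t], where a = ?a])
    fix q assume q: "?a \<le> q" "q < ?a + N"
    have "F ?a (loc q) = F q (loc q)" using traj_unchanged[OF t, of ?a q q] q by simp
    also have "\<dots> = F (q + 1) 0" using traj_hand[OF t, of q] all[of q] q n two_le_l by simp
    also have "\<dots> = q + e" using hand[of "q + 1"] q by simp
    also have "\<dots> = allB n (loc q) + e" using q by (simp add: allB_loc)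
    finally show "F ?a (loc q) = allB n (loc q) + e" .
  qed (use allB_aff_perms[of n] in \<open>simp_all add: allB_0 e_def aff_perms_def affine_bijD\<close>)
  have "disp (F ?a) = (\<Sum>k\<in>{0..<L}. (allB n k - k) + e)"
    unfolding eq disp_def by (simp add: algebra_simps)
  also have "\<dots> = disp (allB n) + L * e" unfolding sum.distrib disp_def by simp
  finally have "e = 0" using traj_aff_perms[OF t, of ?a] allB_aff_perms[of n] two_le_l by (simp add: aff_perms_def)
  then show ?thesis using eq by simp
qed

lemma strip_trailing:
  obtains M' k where "M = M' @ replicate k LA" "M' = [] \<or> last M' = LB"
proof -
  have "\<exists>M' k. M = M' @ replicate k LA \<and> (M' = [] \<or> last M' = LB)"
  proof (induction M rule: rev_induct)
    case Nil
    then show ?case by simp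
  next
    case (snoc c M)
    show ?case
    proof (cases c)
      case LA
      from snoc obtain M' k where "M = M' @ replicate k LA" "M' = [] \<or> last M' = LB" by blast
      then have "M @ [c] = M' @ replicate (Suc k) LA \<and> (M' = [] \<or> last M' = LB)"
        using LA by (simp add: replicate_append_same)
      then show ?thesis by blast
    next
      case LB
      then have "M @ [c] = (M @ [c]) @ replicate 0 LA \<and> (M @ [c] = [] \<or> last (M @ [c]) = LB)" by simp
      then show ?thesis by blast
    qed
  qed
  then show ?thesis using that by blast
qed

lemma arrange_replicate_LA: "arrange f p (replicate k LA) = f"
  by (induction k arbitrary: p) auto

lemma good_prefix: "good l (M @ M') \<Longrightarrow> good l M"
  unfolding good_def
proof (intro allI impI)
  fix i assume *: "\<forall>i. i + (l - 1) < length (M @ M') \<longrightarrow> (M @ M') ! i = LA \<longrightarrow> (M @ M') ! (i + (l - 1)) = LA"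
    and "i + (l - 1) < length M" "M ! i = LA"
  then show "M ! (i + (l - 1)) = LA" using spec[OF *, of i] by (simp add: nth_append)
qed

lemma arrange_allB_surj:
  assumes f: "f \<in> aff_perms"
  obtains n M where "M \<in> good_monomials l" "arrange (allB n) (1 - int n) M = f"
proof -
  obtain b where b: "\<And>q. b \<le> q \<Longrightarrow> f 0 < f (loc q)"
    using eventually_above f by (auto simp: aff_perms_def)
  obtain C F where t: "traj C F" and final: "\<And>p. b \<le> p \<Longrightarrow> F p = f"
    and pos: "\<And>p. F p 0 < F p (loc p)"
    using rewind_traj[OF f b] by blast
  have "F p 0 < F p (loc q)" if "b \<le> p" "p \<le> q" for p q using final b that by simp
  then have min: "F p 0 < F p (loc q)" if "p \<le> q" for p q
    by (rule traj_hand_minimal[OF t pos _ that])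
  obtain a where all: "\<And>p. p < a \<Longrightarrow> C p" using traj_eventually_all[OF t min] by blast
  \<comment> \<open>Chosen so that \<open>1 - int n + 2 * L \<le> a\<close>, the margin that
    \<open>traj_start\<close> asks for.\<close>
  define n where "n = nat (1 + 2 * L - a)"
  let ?a = "1 - int n"
  have start: "F ?a = allB n" by (rule traj_start[OF t pos all]) (auto simp: n_def)
  \<comment> \<open>The letters from time \<open>1 - int n\<close> to \<open>b - 1\<close>; if
    \<open>b\<close> is not after the start, \<open>nat\<close> makes the word empty.\<close>
  define M where "M = map (\<lambda>i. if C (?a + int i) then LB else LA) [0..<nat (b - ?a)]"
  have "F (?a + int j) = arrange (allB n) ?a (take j M)" if "j \<le> length M" for j
    using that
  proof (induction j)
    case 0
    then show ?case by (simp add: start)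
  next
    case (Suc j)
    then have "F (?a + int (Suc j)) = (if C (?a + int j) then F (?a + int j) \<circ> swp (?a + int j) else F (?a + int j))"
      using traj_step[OF t, of "?a + int j"] by (simp add: algebra_simps)
    then show ?case using Suc
      by (simp add: take_Suc_conv_app_nth arrange_append) (auto simp: M_def)
  qed
  from this[of "length M"] have "arrange (allB n) ?a M = F (?a + int (length M))" by simp
  also have "\<dots> = f" by (rule final) (simp add: M_def)
  finally have arrange: "arrange (allB n) ?a M = f" .
  have "good l M" unfolding good_def
  proof (intro allI impI)
    fix i assume i: "i + (l - 1) < length M" "M ! i = LA"
    then have "\<not> C (?a + int i)" by (auto simp: M_def split: if_splits)
    moreover have "?a + int (i + (l - 1)) = ?a + int i + N" using two_le_l by simp
    ultimately have "\<not> C (?a + int (i + (l - 1)))" using traj_closed[OF t min, of "?a + int i"] by metis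
    then show "M ! (i + (l - 1)) = LA" using i(1) by (simp add: M_def)
  qed
  moreover obtain M' k where M': "M = M' @ replicate k LA" "M' = [] \<or> last M' = LB"
    using strip_trailing by blast
  ultimately have "M' \<in> good_monomials l" using good_prefix by (auto simp: good_monomials_def)
  moreover have "arrange (allB n) ?a M' = f" using arrange unfolding M' arrange_append arrange_replicate_LA .
  ultimately show ?thesis using that by blast
qed

section \<open>Isometries of the weight space\<close>

lemma hstar_add: "v \<in> hstar l \<Longrightarrow> w \<in> hstar l \<Longrightarrow> v + w \<in> hstar l"
  and hstar_scale: "v \<in> hstar l \<Longrightarrow> hscale c v \<in> hstar l"
proof -
  assume "v \<in> hstar l" 
  then obtain a d where v: "v = (\<Sum>i<l. hscale (a i) (Lambda l i)) + hscale d delta"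
    by (auto simp: hstar_def)
  have sc: "hscale c (\<Sum>i<l. hscale (a i) (Lambda l i)) = (\<Sum>i<l. hscale (c * a i) (Lambda l i))"
  proof -
    have "hscale c (\<Sum>i<n. hscale (a i) (Lambda l i)) = (\<Sum>i<n. hscale (c * a i) (Lambda l i))" for n
      by (induction n) (simp_all add: hscale_add hscale_hscale)
    then show ?thesis .
  qed
  show "hscale c v \<in> hstar l"
    unfolding v hstar_def by (auto simp: hscale_add sc hscale_hscale)
  {
    assume "w \<in> hstar l"
    then obtain a' d' where w: "w = (\<Sum>i<l. hscale (a' i) (Lambda l i)) + hscale d' delta"
      by (auto simp: hstar_def)
    have "v + w = (\<Sum>i<l. hscale (a i + a' i) (Lambda l i)) + hscale (d + d') delta"
      unfolding v w by (simp add: hscale_add sum.distrib algebra_simps)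
    then show "v + w \<in> hstar l" unfolding hstar_def
      by (intro CollectI exI[of _ "\<lambda>i. a i + a' i"] exI[of _ "d + d'"] conjI TrueI)
  }
qed

lemma hstar_diff: "v \<in> hstar l \<Longrightarrow> w \<in> hstar l \<Longrightarrow> v - w \<in> hstar l"
  using hstar_add[of v "hscale (- 1) w"] hstar_scale[of w "- 1"] by (simp add: hscale_uminus)

lemma hstar_0: "0 \<in> hstar l"
  unfolding hstar_def using two_le_l by (intro CollectI exI[of _ "\<lambda>_. 0"] exI[of _ 0]) simp

lemma hstar_sum: "(\<And>i. i \<in> A \<Longrightarrow> f i \<in> hstar l) \<Longrightarrow> sum f A \<in> hstar l"
  by (induction A rule: infinite_finite_induct) (simp_all add: hstar_0 hstar_add)

lemma hstar_delta: "delta \<in> hstar l"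
  unfolding hstar_def by (intro CollectI exI[of _ "\<lambda>_. 0"] exI[of _ 1]) simp

lemma hstar_Lambda: assumes "i < l" shows "Lambda l i \<in> hstar l"
proof -
  have "(\<Sum>j<l. hscale (if j = i then 1 else 0) (Lambda l j)) = (\<Sum>j<l. if j = i then Lambda l j else 0)"
    by (rule sum.cong) auto
  then have "Lambda l i = (\<Sum>j<l. hscale (if j = i then 1 else 0) (Lambda l j)) + hscale 0 delta"
    using assms by simp
  then show ?thesis unfolding hstar_def
    by (intro CollectI exI[of _ "\<lambda>j. if j = i then 1 else 0"] exI[of _ 0] conjI TrueI)
qed

lemma hstar_Lambda0: "Lambda0 \<in> hstar l"
  using hstar_Lambda[of 0] two_le_l by (simp add: Lambda_def)

lemma sum_eps_bar_all: "(\<Sum>j=1..l. eps_bar l j) = 0"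
  unfolding eps_bar_eq hvec_sum hvec_zero using two_le_l
  by (auto simp: fun_eq_iff sum_subtractf)

text \<open>A difference of consecutive fundamental weights; for \<open>i = l\<close>, the term
  \<open>Lambda l l\<close> equals \<open>Lambda0\<close> because the \<open>eps_bar\<close> sum to
  0.\<close>

lemma hstar_eps_bar: assumes "i \<in> {1..l}" shows "eps_bar l i \<in> hstar l"
proof -
  have Lam: "Lambda l j \<in> hstar l" if "j \<le> l" for j
    using that hstar_Lambda[of j] hstar_Lambda0 sum_eps_bar_all by (cases "j = l") (auto simp: Lambda_def)
  obtain j where j: "i = Suc j" using assms by (cases i) auto
  have "eps_bar l i = Lambda l i - Lambda l j" by (simp add: j Lambda_def)
  then show ?thesis using assms j Lam by (auto intro: hstar_diff)
qed

lemma hstar_decomp: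
  assumes "\<And>i. i \<notin> {1..l} \<Longrightarrow> x i = 0" "(\<Sum>i=1..l. x i) = 0"
  shows "(x, k, d) = (\<Sum>j=1..l. hscale (x j) (eps_bar l j)) + hscale k Lambda0 + hscale d delta"
  using sum_eps_bar[of l x] assms two_le_l
  by (auto simp: Lambda0_eq delta_eq hvec_simps fun_eq_iff)

text \<open>The coordinate test for membership, used for permutations and translations. The zero sum
  comes from the overlining.\<close>

lemma hstar_iff:
  "(x, k, d) \<in> hstar l \<longleftrightarrow> (\<forall>i. i \<notin> {1..l} \<longrightarrow> x i = 0) \<and> (\<Sum>i=1..l. x i) = 0" (is "?A \<longleftrightarrow> ?B")
proof
  assume ?B
  then have "(x, k, d) = (\<Sum>j=1..l. hscale (x j) (eps_bar l j)) + hscale k Lambda0 + hscale d delta"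
    by (intro hstar_decomp) auto
  then show ?A
    by (auto intro!: hstar_add hstar_scale hstar_sum hstar_eps_bar hstar_Lambda0 hstar_delta)
next
  define S :: "hvec set" where "S = {(x, k, d). (\<forall>i. i \<notin> {1..l} \<longrightarrow> x i = 0) \<and> (\<Sum>i=1..l. x i) = 0}"
  have add: "v + w \<in> S" if "v \<in> S" "w \<in> S" for v w
    using that by (auto simp: S_def hvec_add sum.distrib)
  have scale: "hscale c v \<in> S" if "v \<in> S" for c v
    using that by (auto simp: S_def hvec_scale simp flip: sum_distrib_left)
  have zero: "0 \<in> S" by (simp add: S_def hvec_zero)
  have sum: "sum f A \<in> S" if "\<And>i. i \<in> A \<Longrightarrow> f i \<in> S" for f and A :: "nat set"
    using that by (induction A rule: infinite_finite_induct) (auto simp: zero add)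
  have "eps_bar l i \<in> S" if "i \<in> {1..l}" for i
    using that by (auto simp: S_def eps_bar_eq sum_subtractf)
  then have "Lambda l i \<in> S" if "i < l" for i
    unfolding Lambda_def using that
    by (intro add sum) (auto simp: S_def Lambda0_eq)
  moreover have "delta \<in> S" by (simp add: S_def delta_eq)
  ultimately have "hstar l \<subseteq> S" unfolding hstar_def by (auto intro!: add sum scale)
  moreover assume ?A
  ultimately show ?B by (auto simp: S_def)
qed

text \<open>A common home for the affine Weyl group and \<open>s_elem\<close>, in which an element
  is determined by its values on the affine weights (\<open>isos_fix\<close>).\<close>

definition isos :: "(hvec \<Rightarrow> hvec) set" where
  "isos = {g \<in> Bij (hstar l). (\<forall>v\<in>hstar l. \<forall>w\<in>hstar l. g (v + w) = g v + g w \<and> hform l (g v) (g w) = hform l v w) \<and>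
     (\<forall>c. \<forall>v\<in>hstar l. g (hscale c v) = hscale c (g v)) \<and> g delta = delta}"

lemma isosD:
  assumes "g \<in> isos"
  shows "g \<in> Bij (hstar l)" "v \<in> hstar l \<Longrightarrow> g v \<in> hstar l"
    "v \<in> hstar l \<Longrightarrow> w \<in> hstar l \<Longrightarrow> g (v + w) = g v + g w"
    "v \<in> hstar l \<Longrightarrow> w \<in> hstar l \<Longrightarrow> hform l (g v) (g w) = hform l v w"
    "v \<in> hstar l \<Longrightarrow> g (hscale c v) = hscale c (g v)" "g delta = delta"
    "v \<in> hstar l \<Longrightarrow> w \<in> hstar l \<Longrightarrow> g v = g w \<longleftrightarrow> v = w"
  using assms by (auto simp: isos_def Bij_def bij_betw_def inj_on_def)

lemma isos_sum: "g \<in> isos \<Longrightarrow> (\<And>i. i \<in> A \<Longrightarrow> f i \<in> hstar l) \<Longrightarrow> g (sum f A) = (\<Sum>i\<in>A. g (f i))"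
proof (induction A rule: infinite_finite_induct)
  case (insert x A)
  then show ?case by (simp add: isosD(3) hstar_sum)
qed (use isosD(5)[of g 0 0] hstar_0 in auto)

lemma isosI:
  assumes "\<And>v. v \<in> hstar l \<Longrightarrow> G v \<in> hstar l" "\<And>v. v \<in> hstar l \<Longrightarrow> H v \<in> hstar l"
    "\<And>v. v \<in> hstar l \<Longrightarrow> H (G v) = v" "\<And>v. v \<in> hstar l \<Longrightarrow> G (H v) = v"
    "\<And>v w. v \<in> hstar l \<Longrightarrow> w \<in> hstar l \<Longrightarrow> G (v + w) = G v + G w"
    "\<And>v w. v \<in> hstar l \<Longrightarrow> w \<in> hstar l \<Longrightarrow> hform l (G v) (G w) = hform l v w"
    "\<And>c v. v \<in> hstar l \<Longrightarrow> G (hscale c v) = hscale c (G v)" "G delta = delta"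
  shows "(\<lambda>v\<in>hstar l. G v) \<in> isos"
proof -
  have "bij_betw G (hstar l) (hstar l)"
    by (rule bij_betw_byWitness[where f' = H]) (use assms in auto)
  then have "(\<lambda>v\<in>hstar l. G v) \<in> Bij (hstar l)"
    by (simp add: Bij_def bij_betw_cong[of "hstar l" "restrict G (hstar l)" G])
  then show ?thesis using assms by (simp add: isos_def hstar_add hstar_scale hstar_delta)
qed

abbreviation BG where "BG \<equiv> BijGroup (hstar l)"

lemma BG_group: "group BG"
  by (rule group_BijGroup)

lemma BG_carrier: "carrier BG = Bij (hstar l)"
  by (simp add: BijGroup_def)

lemma BG_mult: "g \<in> Bij (hstar l) \<Longrightarrow> h \<in> Bij (hstar l) \<Longrightarrow> v \<in> hstar l \<Longrightarrow> (g \<otimes>\<^bsub>BG\<^esub> h) v = g (h v)"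
  by (simp add: BijGroup_def compose_def)

lemma isos_one: "\<one>\<^bsub>BG\<^esub> \<in> isos"
  unfolding BijGroup_def by (simp, rule isosI[where H = "\<lambda>v. v"]) auto

lemma isos_mult:
  assumes "g \<in> isos" "h \<in> isos" shows "g \<otimes>\<^bsub>BG\<^esub> h \<in> isos"
proof -
  have B: "g \<in> Bij (hstar l)" "h \<in> Bij (hstar l)" using assms isosD(1) by auto
  have "g \<otimes>\<^bsub>BG\<^esub> h \<in> Bij (hstar l)"
    using monoid.m_closed[OF group.is_monoid[OF BG_group]] B by (simp add: BG_carrier)
  then show ?thesis unfolding isos_def
    using isosD(2-6)[OF assms(1)] isosD(2-6)[OF assms(2)]
    by (simp add: BG_mult[OF B] hstar_add hstar_scale hstar_delta)
qed

lemma BG_inv: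
  assumes "g \<in> Bij (hstar l)" "v \<in> hstar l"
  shows "(inv\<^bsub>BG\<^esub> g) (g v) = v" "g ((inv\<^bsub>BG\<^esub> g) v) = v" "(inv\<^bsub>BG\<^esub> g) v \<in> hstar l"
  using assms unfolding inv_BijGroup[OF assms(1)]
  by (auto simp: Bij_def bij_betw_def f_inv_into_f inv_into_into)

lemma isos_inv:
  assumes "g \<in> isos" shows "inv\<^bsub>BG\<^esub> g \<in> isos"
proof -
  let ?h = "inv\<^bsub>BG\<^esub> g"
  have B: "g \<in> Bij (hstar l)" using assms isosD(1) by auto
  have hB: "?h \<in> Bij (hstar l)"
    using group.inv_closed[OF BG_group] B by (simp add: BG_carrier)
  have eqI: "?h w = v" if "g v = w" "v \<in> hstar l" for v w
    using that BG_inv(1)[OF B, of v] by simp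
  show ?thesis unfolding isos_def
  proof (intro CollectI conjI ballI allI hB)
    fix v w assume vw: "v \<in> hstar l" "w \<in> hstar l"
    show "?h (v + w) = ?h v + ?h w"
      using vw by (intro eqI) (simp_all add: isosD(3)[OF assms] BG_inv[OF B] hstar_add)
    show "hform l (?h v) (?h w) = hform l v w"
      using vw isosD(4)[OF assms, of "?h v" "?h w"] by (simp add: BG_inv[OF B])
  next
    fix c v assume "v \<in> hstar l"
    then show "?h (hscale c v) = hscale c (?h v)"
      by (intro eqI) (simp_all add: isosD(5)[OF assms] BG_inv[OF B] hstar_scale)
  next
    show "?h delta = delta" by (intro eqI isosD(6)[OF assms] hstar_delta)
  qed
qed

section \<open>The Weyl group as a group of affine permutations\<close>

lemma transl_eq: "transl l (g, 0, 0) (x, k, d) =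
  (\<lambda>i. x i + k * g i, k, d - (k * (\<Sum>i=1..l. g i * g i) / 2 + (\<Sum>i=1..l. g i * x i)))"
  by (simp add: transl_def hform_def delta_eq hvec_simps fun_eq_iff)

lemma perm_act_eq: "perm_act \<sigma> (x, k, d) = (\<lambda>i. x (inv_into UNIV \<sigma> i), k, d)"
  by (simp add: perm_act_def)

lemma hstar_perm_act:
  assumes "\<sigma> permutes {1..l}" "v \<in> hstar l" shows "perm_act \<sigma> v \<in> hstar l"
proof -
  obtain x k d where v: "v = (x, k, d)" by (cases v) auto
  have "inv_into UNIV \<sigma> i \<notin> {1..l}" if "i \<notin> {1..l}" for i
    using permutes_in_image[OF permutes_inv[OF assms(1)], of i] that by simp
  then show ?thesis using assms(2) sum.permute[OF permutes_inv[OF assms(1)], of x]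
    unfolding v perm_act_eq hstar_iff by (simp add: o_def)
qed

lemma hform_perm_act:
  assumes "\<sigma> permutes {1..l}" shows "hform l (perm_act \<sigma> v) (perm_act \<sigma> w) = hform l v w"
proof -
  obtain x k d x' k' d' where v: "v = (x, k, d)" "w = (x', k', d')" by (cases v; cases w) auto
  show ?thesis using sum.permute[OF permutes_inv[OF assms(1)], of "\<lambda>i. x i * x' i"]
    unfolding v perm_act_eq hform_eq by (simp add: o_def)
qed

lemma perm_act_inverse:
  assumes "\<sigma> permutes S"
  shows "perm_act (inv_into UNIV \<sigma>) (perm_act \<sigma> v) = v" "perm_act \<sigma> (perm_act (inv_into UNIV \<sigma>) v) = v"
  using assms by (simp_all add: perm_act_def case_prod_beta permutes_inverses permutes_inv_inv)

lemma hstar_transl: "(g, 0, 0) \<in> hstar l \<Longrightarrow> v \<in> hstar l \<Longrightarrow> transl l (g, 0, 0) v \<in> hstar l"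
  by (cases v) (simp add: transl_eq hstar_iff sum.distrib flip: sum_distrib_left)

lemma hform_transl: "hform l (transl l (g, 0, 0) v) (transl l (g, 0, 0) w) = hform l v w"
proof -
  obtain x k d x' k' d' where v: "v = (x, k, d)" "w = (x', k', d')" by (cases v; cases w) auto
  have "(\<Sum>i=1..l. (x i + k * g i) * (x' i + k' * g i)) = (\<Sum>i=1..l. x i * x' i) +
     k' * (\<Sum>i=1..l. g i * x i) + k * (\<Sum>i=1..l. g i * x' i) + k * k' * (\<Sum>i=1..l. g i * g i)"
    by (simp add: algebra_simps sum.distrib sum_distrib_left)
  then show ?thesis unfolding v transl_eq hform_eq by (simp add: field_simps)
qed

lemma transl_inverse: "transl l (\<lambda>i. - g i, 0, 0) (transl l (g, 0, 0) v) = v"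
proof -
  obtain x k d where v: "v = (x, k, d)" by (cases v) auto
  have "(\<Sum>i=1..l. g i * (x i + k * g i)) = (\<Sum>i=1..l. g i * x i) + k * (\<Sum>i=1..l. g i * g i)"
    by (simp add: algebra_simps sum.distrib sum_distrib_left)
  then show ?thesis unfolding v transl_eq by (simp add: sum_negf)
qed

lemma transl_linear:
  "transl l \<gamma> (v + w) = transl l \<gamma> v + transl l \<gamma> w"
  "transl l \<gamma> (hscale c v) = hscale c (transl l \<gamma> v)"
proof -
  have "transl l \<gamma> (v + w) = (v + w) + (hscale (hform l v delta) \<gamma> + hscale (hform l w delta) \<gamma>)
    - (hscale (1/2 * hform l v delta * hform l \<gamma> \<gamma> + hform l \<gamma> v) delta
       + hscale (1/2 * hform l w delta * hform l \<gamma> \<gamma> + hform l \<gamma> w) delta)"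
    unfolding transl_def hform_linear hscale_add(1)[symmetric] by (simp add: algebra_simps add_divide_distrib)
  then show "transl l \<gamma> (v + w) = transl l \<gamma> v + transl l \<gamma> w" unfolding transl_def by (simp add: algebra_simps)
  show "transl l \<gamma> (hscale c v) = hscale c (transl l \<gamma> v)"
    unfolding transl_def hform_linear hscale_add hscale_hscale by (simp add: algebra_simps)
qed

text \<open>Stated for any level-0 vector \<open>(g, 0, 0)\<close> of \<open>hstar l\<close>, to
  cover both the root lattice and the weight in \<open>s_elem\<close>.\<close>

lemma aff_elem_isos:
  assumes g: "(g, 0, 0) \<in> hstar l" and \<sigma>: "\<sigma> permutes {1..l}"
  shows "aff_elem l (g, 0, 0) \<sigma> \<in> isos"
  unfolding aff_elem_def
proof (rule isosI[where H = "\<lambda>v. perm_act (inv_into UNIV \<sigma>) (transl l (\<lambda>i. - g i, 0, 0) v)"])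
  have g': "(\<lambda>i. - g i, 0, 0) \<in> hstar l" using g by (simp add: hstar_iff sum_negf)
  have inv: "transl l (g, 0, 0) (transl l (\<lambda>i. - g i, 0, 0) v) = v" for v
    using transl_inverse[of "\<lambda>i. - g i" v] by simp
  show "transl l (g, 0, 0) (perm_act \<sigma> (perm_act (inv_into UNIV \<sigma>) (transl l (\<lambda>i. - g i, 0, 0) v))) = v" for v
    by (simp add: perm_act_inverse[OF \<sigma>] inv)
  show "perm_act (inv_into UNIV \<sigma>) (transl l (\<lambda>i. - g i, 0, 0) v) \<in> hstar l" if "v \<in> hstar l" for v
    using that by (intro hstar_perm_act permutes_inv \<sigma> hstar_transl g')
  have "transl l (g, 0, 0) delta = delta" by (simp add: delta_eq transl_eq)
  then show "transl l (g, 0, 0) (perm_act \<sigma> delta) = delta" by (simp only: perm_act_simps)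
qed (use g \<sigma> in \<open>simp_all add: hstar_transl hstar_perm_act perm_act_inverse[OF \<sigma>] transl_inverse
       transl_linear perm_act_simps hform_transl hform_perm_act\<close>)

section \<open>Affine weights labelled by integers\<close>

definition idx :: "int \<Rightarrow> nat" where "idx k = nat (k mod L) + 1"

text \<open>The affine weights indexed by integers: \<open>ev (m * L + i) = eps_bar l (i + 1) - m \<delta>\<close> for \<open>0 \<le> i < L\<close>.\<close>

definition ev :: "int \<Rightarrow> hvec" where
  "ev k = eps_bar l (idx k) - hscale (of_int (k div L)) delta"

lemma idx_range: "idx k \<in> {1..l}"
proof -
  have "0 \<le> k mod L" "k mod L < L" using two_le_l by simp_all
  then have "nat (k mod L) < l" by linarith
  then show ?thesis by (simp add: idx_def)
qed

lemma idx_eq_iff: "idx k = idx j \<longleftrightarrow> k mod L = j mod L"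
  using two_le_l by (simp add: idx_def eq_nat_nat_iff)

lemma idx_shift [simp]: "idx (k + m * L) = idx k"
  by (simp add: idx_eq_iff)

lemma idx_div_of:
  assumes "i \<in> {1..l}" shows "idx (int i - 1 + m * L) = i" "(int i - 1 + m * L) div L = m"
  using assms two_le_l by (auto simp: idx_def)

lemma idx_decomp: "int (idx k) - 1 + k div L * L = k"
  using two_le_l by (simp add: idx_def)

lemma ev_eq: "ev k = (\<lambda>j. (if j = idx k then 1 else 0) - (if j \<in> {1..l} then 1 / of_nat l else 0), 0, - of_int (k div L))"
  unfolding ev_def eps_bar_eq delta_eq by (simp add: hvec_simps fun_eq_iff)

lemma hstar_ev: "ev k \<in> hstar l"
  unfolding ev_def by (intro hstar_diff hstar_scale hstar_delta hstar_eps_bar idx_range)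

lemma ev_shift: "ev (k + m * L) = ev k - hscale (of_int m) delta"
proof -
  have "(k + m * L) div L = k div L + m" using two_le_l by simp
  then show ?thesis unfolding ev_def by (simp add: hscale_add algebra_simps)
qed

lemma eps_bar_ev: "i \<in> {1..l} \<Longrightarrow> eps_bar l i = ev (int i - 1)"
  using idx_div_of[of i 0] by (simp add: ev_def)

lemma ev_inj: assumes "ev k = ev j" shows "k = j"
proof -
  have d: "k div L = j div L" using assms by (simp add: ev_eq)
  have "fst (ev k) (idx k) = fst (ev j) (idx k)" using assms by simp
  then have "idx k = idx j" by (simp add: ev_eq split: if_splits)
  then have "k mod L = j mod L" by (simp only: idx_eq_iff)
  then show ?thesis using d by (metis div_mult_mod_eq)
qed

lemma hform_delta: "hform l (x, k, d) delta = k"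
  by (simp add: delta_eq hform_eq)

text \<open>The correction \<open>1 / of_nat l\<close> drops out because the coordinates of a vector
  in \<open>hstar l\<close> sum to 0.\<close>

lemma hform_ev:
  assumes "(x, k, d) \<in> hstar l" shows "hform l (x, k, d) (ev j) = x (idx j) - k * of_int (j div L)"
proof -
  have "(\<Sum>i=1..l. x i * ((if i = idx j then 1 else 0) - (if i \<in> {1..l} then 1 / of_nat l else 0)))
      = (\<Sum>i=1..l. (if i = idx j then x i else 0) - x i / of_nat l)"
    by (rule sum.cong) (auto simp: algebra_simps)
  also have "\<dots> = x (idx j) - (\<Sum>i=1..l. x i) / of_nat l"
    using idx_range[of j] by (simp add: sum_subtractf sum_divide_distrib)
  finally show ?thesis using assms unfolding ev_eq hform_eq by (simp add: hstar_iff)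
qed

lemma hform_ev_ev: "hform l (ev k) (ev j) = (if k mod L = j mod L then 1 else 0) - 1 / of_nat l"
  using hform_ev[OF hstar_ev[of k, unfolded ev_eq], of j] idx_range[of j] idx_eq_iff[of j k]
  unfolding ev_eq[symmetric] by auto

text \<open>
  An isometry is determined on \<open>\<Lambda>\<^sub>0\<close> by its values at level 0, because the form is nondegenerate and
  \<open>\<Lambda>\<^sub>0\<close> is isotropic.
\<close>

lemma isos_fix:
  assumes h: "h \<in> isos" and fixed: "\<And>k. h (ev k) = ev k" and v: "v \<in> hstar l"
  shows "h v = v"
proof -
  obtain x k d where a: "h Lambda0 = (x, k, d)" by (cases "h Lambda0") auto
  have aS: "(x, k, d) \<in> hstar l" using isosD(2)[OF h hstar_Lambda0] a by simp
  have L0: "(\<lambda>i. 0, 1, 0) \<in> hstar l" using hstar_Lambda0 by (simp add: Lambda0_eq)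
  have k: "k = 1"
    using isosD(4)[OF h hstar_Lambda0 hstar_delta] unfolding a isosD(6)[OF h]
    by (simp add: hform_delta Lambda0_eq)
  have x: "x i = 0" for i
  proof (cases "i \<in> {1..l}")
    case True
    then show ?thesis
      using isosD(4)[OF h hstar_Lambda0 hstar_ev, of "int i - 1"] idx_div_of[of i 0]
      unfolding a fixed unfolding Lambda0_eq hform_ev[OF aS] hform_ev[OF L0] by simp
  next
    case False
    then show ?thesis using aS unfolding hstar_iff by blast
  qed
  have "d = 0"
    using isosD(4)[OF h hstar_Lambda0 hstar_Lambda0] unfolding a
    by (simp add: Lambda0_eq hform_eq x k)
  then have L: "h Lambda0 = Lambda0" unfolding a unfolding Lambda0_eq using x k by auto
  obtain y k d where v_eq: "v = (y, k, d)" by (cases v) auto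
  define z where "z = (\<Sum>j=1..l. hscale (y j) (eps_bar l j))"
  have dec: "v = z + hscale k Lambda0 + hscale d delta"
    using hstar_decomp[of y k d] v unfolding v_eq hstar_iff z_def by blast
  have S: "z \<in> hstar l" unfolding z_def
    by (intro hstar_sum hstar_scale hstar_eps_bar)
  have "h z = (\<Sum>j=1..l. h (hscale (y j) (eps_bar l j)))" unfolding z_def
    by (intro isos_sum h hstar_scale hstar_eps_bar)
  also have "\<dots> = z" unfolding z_def
    by (intro sum.cong refl) (simp add: isosD(5)[OF h] hstar_eps_bar eps_bar_ev fixed hstar_ev)
  finally have "h z = z" .
  then show ?thesis unfolding dec
    by (simp add: isosD(3,5,6)[OF h] S hstar_add hstar_scale hstar_Lambda0 hstar_delta L)
qed

text \<open>\<open>f\<close> records the inverse of the action of \<open>g\<close>, sending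
  positions to labels, so products turn into compositions in reverse order
  (\<open>rep_mult\<close>).\<close>

definition rep :: "(hvec \<Rightarrow> hvec) \<Rightarrow> (int \<Rightarrow> int) \<Rightarrow> bool" where
  "rep g f \<longleftrightarrow> g \<in> isos \<and> (\<forall>k. g (ev (f k)) = ev k)"

lemma rep_one: "rep \<one>\<^bsub>BG\<^esub> id"
  unfolding rep_def using isos_one hstar_ev by (auto simp: BijGroup_def)

lemma rep_mult: "rep g f \<Longrightarrow> rep g' f' \<Longrightarrow> rep (g \<otimes>\<^bsub>BG\<^esub> g') (f' \<circ> f)"
  unfolding rep_def by (simp add: isos_mult BG_mult isosD(1) hstar_ev)

text \<open>The quotient of the two elements fixes every affine weight, so by
  \<open>isos_fix\<close> it is the identity on \<open>hstar l\<close>; outside, both are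
  undefined.\<close>

lemma rep_unique:
  assumes "rep g f" "rep g' f" "surj f" shows "g = g'"
proof -
  have g: "g \<in> isos" "g' \<in> isos" using assms by (auto simp: rep_def)
  let ?i = "inv\<^bsub>BG\<^esub> g'"
  have i: "?i \<in> isos" by (rule isos_inv[OF g(2)])
  have "?i (g (ev j)) = ev j" for j
  proof -
    obtain k where "j = f k" using \<open>surj f\<close> by blast
    then have "g (ev j) = g' (ev j)" using assms by (simp add: rep_def)
    then show ?thesis using BG_inv(1)[OF isosD(1)[OF g(2)] hstar_ev] by simp
  qed
  then have "(?i \<otimes>\<^bsub>BG\<^esub> g) v = v" if "v \<in> hstar l" for v
    using isos_fix[OF isos_mult[OF i g(1)] _ that] by (simp add: BG_mult isosD(1) i g hstar_ev)
  then have "?i (g v) = v" if "v \<in> hstar l" for v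
    using that by (simp add: BG_mult isosD(1) i g)
  then have "g v = g' v" if "v \<in> hstar l" for v
    using that BG_inv(2)[OF isosD(1)[OF g(2)], of "g v"] isosD(2)[OF g(1) that] by simp
  moreover have "g \<in> extensional (hstar l)" "g' \<in> extensional (hstar l)"
    using g isosD(1) by (auto simp: Bij_def)
  ultimately show ?thesis by (intro extensionalityI)
qed

lemma rep_inj:
  assumes "rep g f" "rep g f'" shows "f = f'"
proof
  fix k
  have "g (ev (f k)) = g (ev (f' k))" using assms by (simp add: rep_def)
  then have "ev (f k) = ev (f' k)" using assms isosD(7)[of g "ev (f k)" "ev (f' k)"] by (simp add: rep_def hstar_ev)
  then show "f k = f' k" by (rule ev_inj)
qed

lemma hform_root: "hform l (ev k) (ev 0 - ev (loc q)) =
   (if k mod L = 0 then 1 else 0) - (if k mod L = loc q mod L then 1 else 0)"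
  by (simp add: hform_linear hform_ev_ev)

lemma hform_root_root: "hform l (ev 0 - ev (loc q)) (ev 0 - ev (loc q)) = 2"
  using loc_mod_pos[of q] by (simp add: hform_linear(2) hform_root)

lemma reflection_isos:
  assumes \<gamma>: "\<gamma> \<in> hstar l" "hform l \<gamma> \<gamma> = 2" "hform l \<gamma> delta = 0"
  shows "reflection l \<gamma> \<in> isos"
proof -
  let ?G = "\<lambda>v. v - hscale (hform l v \<gamma>) \<gamma>"
  have inv: "?G (?G v) = v" for v
  proof -
    have "hform l (?G v) \<gamma> = - hform l v \<gamma>" by (simp add: hform_linear \<gamma>)
    then show ?thesis by (simp add: hscale_uminus)
  qed
  have "(\<lambda>v\<in>hstar l. ?G v) \<in> isos"
  proof (rule isosI[where H = ?G])
    show "hform l (?G v) (?G w) = hform l v w" for v w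
      by (simp add: hform_linear \<gamma>(2) hform_commute[of l \<gamma> w] algebra_simps)
    show "?G delta = delta" using \<gamma>(3) by (simp add: hform_commute[of l delta])
    show "?G (v + w) = ?G v + ?G w" for v w
      unfolding hform_linear hscale_add(1) by simp
    show "?G (hscale c v) = hscale c (?G v)" for c v
      unfolding hform_linear hscale_add(3) hscale_hscale ..
  qed (simp_all only: inv hstar_diff hstar_scale \<gamma>(1))
  then show ?thesis unfolding reflection_def \<gamma>(2) by simp
qed

text \<open>The root pairs to 1 with the class of 0, to -1 with the class of \<open>loc q\<close>
  and to 0 otherwise: the three cases of \<open>swp\<close>.\<close>

lemma rep_reflection: "rep (reflection l (ev 0 - ev (loc q))) (swp q)"
proof -
  let ?\<gamma> = "ev 0 - ev (loc q)"
  have \<gamma>: "?\<gamma> \<in> hstar l" by (intro hstar_diff hstar_ev)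
  have "hform l ?\<gamma> delta = 0" unfolding hform_linear ev_eq hform_delta by simp
  then have iso: "reflection l ?\<gamma> \<in> isos" by (intro reflection_isos \<gamma> hform_root_root)
  have "reflection l ?\<gamma> (ev k) = ev (swp q k)" for k
  proof -
    have R: "reflection l ?\<gamma> (ev k) = ev k - hscale (hform l (ev k) ?\<gamma>) ?\<gamma>"
      by (simp add: reflection_def hstar_ev hform_root_root)
    have pos: "loc q mod L \<noteq> 0" using loc_mod_pos[of q] by simp
    consider "k mod L = 0" | "k mod L = loc q mod L" | "k mod L \<noteq> 0" "k mod L \<noteq> loc q mod L" by blast
    then show ?thesis
    proof cases
      case 1
      define m where "m = k div L"
      have k: "k = 0 + m * L" using div_mult_mod_eq[of k L] 1 by (simp add: m_def)
      have "ev (swp q k) = ev (loc q) - hscale (of_int m) delta"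
        using 1 by (simp add: swp_def k add.commute flip: ev_shift)
      moreover have "ev k = ev 0 - hscale (of_int m) delta" unfolding k ev_shift ..
      ultimately show ?thesis unfolding R hform_root using 1 pos by simp
    next
      case 2
      then obtain m where m: "k = loc q + m * L"
        unfolding mod_eq_dvd_iff dvd_def by (auto simp: algebra_simps diff_eq_eq)
      have "ev (swp q k) = ev (0 + m * L)" using 2 pos by (simp add: swp_def m)
      moreover have "ev k = ev (loc q) - hscale (of_int m) delta" unfolding m ev_shift ..
      ultimately show ?thesis unfolding R hform_root ev_shift using 2 pos by (simp add: hscale_uminus)
    next
      case 3
      then show ?thesis unfolding R hform_root by (simp add: swp_def)
    qed
  qed
  \<comment> \<open>\<open>rep\<close> asks for the inverse of the action, which is
    \<open>swp q\<close> again.\<close>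
  then show ?thesis using iso by (simp add: rep_def)
qed

text \<open>Residue and quotient of the location give the finite root and the multiple of \<delta>,
  which \<open>ev\<close> carries with a minus sign.\<close>

lemma beta_ev: "beta l (Suc i) = ev 0 - ev (loc (1 + int i))"
proof -
  have N: "N = int (l - 1)" using two_le_l by simp
  have div: "loc (1 + int i) div L = int (i div (l - 1))"
    unfolding loc_div N by (simp add: zdiv_int)
  have "loc (1 + int i) mod L = int (i mod (l - 1) + 1)"
    unfolding loc_mod N by (simp add: zmod_int)
  then have "idx (loc (1 + int i)) = i mod (l - 1) + 1 + 1" unfolding idx_def by simp
  moreover have "idx 0 = 1" by (simp add: idx_def)
  ultimately show ?thesis unfolding ev_def div beta_def
    by (simp add: fin_root_eq Let_def)
qed

text \<open>Induction from the right end, since the last letter gives the outermost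
  reflection.\<close>

lemma rep_w_good: "rep (w_good l M) (arrange (allB 0) 1 M)"
proof (induction M rule: rev_induct)
  case Nil
  have "w_good l [] = \<one>\<^bsub>BG\<^esub>" by (simp add: w_good_def gammas_def)
  then show ?case using rep_one by (simp only: arrange.simps allB.simps(1))
next
  case (snoc c M)
  have "filter (\<lambda>i. (M @ [c]) ! i \<noteq> LA) [0..<length M] = filter (\<lambda>i. M ! i \<noteq> LA) [0..<length M]"
    by (rule filter_cong) (auto simp: nth_append)
  then have "gammas l (M @ [c]) = gammas l M @ (if c = LA then [] else [beta l (Suc (length M))])"
    by (simp add: gammas_def)
  then have w: "w_good l (M @ [c]) = (if c = LA then w_good l M
      else reflection l (beta l (Suc (length M))) \<otimes>\<^bsub>BG\<^esub> w_good l M)"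
    by (simp add: w_good_def)
  show ?case
  proof (cases c)
    case LA
    then show ?thesis using snoc w by (simp add: arrange_append)
  next
    case LB
    then show ?thesis
      using rep_mult[OF rep_reflection snoc, of "1 + int (length M)"] w
      by (simp only: arrange_append arrange.simps beta_ev letter.distinct simp_thms if_True if_False)
  qed
qed

text \<open>
  The action of \<open>s\<close> on the integers. It holds only up to a shift by \<open>\<delta>/l\<close> (see \<open>s_elem_ev\<close>), as \<open>s\<close> lies in the
  extended group only; the shift cancels under conjugation.
\<close>

definition tau :: "int \<Rightarrow> int" where
  "tau k = (if k mod L = 0 then k else if k mod L = N then k + 2 else k + 1)"

lemma tau_add_L: "tau (k + m * L) = tau k + m * L"
  by (simp add: tau_def)

lemma tau_0 [simp]: "tau 0 = 0"
  by (simp add: tau_def)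

text \<open>The next location is two further on exactly when a multiple of \<open>L\<close> lies
  between, that is, at residue \<open>N\<close>.\<close>

lemma tau_loc: "tau (loc q) = loc (q + 1)"
proof -
  define r d where "r = (q - 1) mod N" and "d = (q - 1) div N"
  have r: "0 \<le> r" "r < N" using N_pos by (simp_all add: r_def)
  have q: "q = (r + 1) + d * N" using div_mult_mod_eq[of "q - 1" N] by (simp add: r_def d_def)
  have mod: "loc q mod L = r + 1" by (simp add: loc_mod r_def)
  show ?thesis
  proof (cases "r + 1 = N")
    case True
    then have q: "q = (d + 1) * N" using q by (simp add: algebra_simps)
    have "q div N = d + 1" unfolding q using N_pos by simp
    then show ?thesis unfolding tau_def mod using True N_pos by (simp add: loc_def d_def)
  next
    case False
    have "q div N = (r + 1 + d * N) div N" using q by simp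
    also have "\<dots> = d" using False r by simp
    finally show ?thesis unfolding tau_def mod using False r by (simp add: loc_def d_def)
  qed
qed

text \<open>The integer form of the fact that conjugation by \<open>s\<close> takes the reflection
  in \<beta>_q to the next one: \<open>tau\<close> fixes 0 and moves location \<open>q\<close> to
  \<open>q + 1\<close>.\<close>

lemma tau_swp: "tau \<circ> swp q = swp (q + 1) \<circ> tau"
proof
  fix k
  have sw: "swp p (j + m * L) = swp p j + m * L" for p j m by (rule affine_bij_shift[OF affine_bij_swp])
  show "(tau \<circ> swp q) k = (swp (q + 1) \<circ> tau) k"
  proof (cases k rule: loc_cases)
    case (1 m)
    then have k: "k = 0 + m * L" by simp
    show ?thesis unfolding k by (simp only: o_apply sw tau_add_L swp_0 tau_0 tau_loc)
  next
    case (2 p)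
    show ?thesis
    proof (cases "p mod N = q mod N")
      case True
      then obtain m where m: "p = q + m * N"
        unfolding mod_eq_dvd_iff dvd_def by (auto simp: algebra_simps diff_eq_eq)
      show ?thesis unfolding 2 m loc_shift by (simp only: o_apply sw tau_add_L swp_loc tau_0 tau_loc)
    next
      case False
      then have "(p + 1) mod N \<noteq> (q + 1) mod N" by (simp add: mod_eq_dvd_iff)
      then show ?thesis unfolding 2 by (simp add: tau_loc swp_loc_other False)
    qed
  qed
qed

text \<open>Moving \<open>tau\<close> leftwards past each exchange by \<open>tau_swp\<close> lowers
  its time by one.\<close>

lemma arrange_tau: "f \<circ> tau = tau \<circ> g \<Longrightarrow> arrange f p M \<circ> tau = tau \<circ> arrange g (p - 1) M"
proof (induction M arbitrary: f g p)
  case (Cons c M)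
  have "(f \<circ> swp p) \<circ> tau = f \<circ> tau \<circ> swp (p - 1)"
    using tau_swp[of "p - 1"] by (simp add: comp_assoc)
  also have "\<dots> = tau \<circ> (g \<circ> swp (p - 1))" unfolding Cons.prems by (simp add: comp_assoc)
  finally have "(f \<circ> swp p) \<circ> tau = tau \<circ> (g \<circ> swp (p - 1))" .
  with Cons.prems
  have "(if c = LB then f \<circ> swp p else f) \<circ> tau = tau \<circ> (if c = LB then g \<circ> swp (p - 1) else g)"
    by (cases "c = LB") (simp_all only: if_True if_False simp_thms)
  from Cons.IH[OF this, of "p + 1"] show ?case by simp
qed simp

text \<open>The recursion defining \<open>w\<close> for pure powers of \<open>B^-1\<close>. The
  right factor, the reflection in \<alpha>_12, becomes \<open>swp 1\<close> on the left, and
  \<open>tau\<close> shifts every exchange back by one.\<close>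

lemma allB_tau: "(swp 1 \<circ> allB n) \<circ> tau = tau \<circ> allB (Suc n)"
proof (induction n)
  case 0
  show ?case using tau_swp[of 0] by (simp add: allB.simps)
next
  case (Suc n)
  have "(swp 1 \<circ> allB (Suc n)) \<circ> tau = (swp 1 \<circ> allB n) \<circ> (swp (- int n) \<circ> tau)"
    by (simp only: allB.simps comp_assoc)
  also have "\<dots> = (swp 1 \<circ> allB n) \<circ> tau \<circ> swp (- int (Suc n))"
    using tau_swp[of "- int (Suc n)"] by (simp add: comp_assoc)
  also have "\<dots> = tau \<circ> (allB (Suc n) \<circ> swp (- int (Suc n)))"
    unfolding Suc by (simp only: comp_assoc)
  finally show ?case by (simp only: allB.simps(2)[of "Suc n"])
qed

section \<open>The action of s on the affine weights\<close>

lemma cycle_values: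
  assumes "2 \<le> j" "j \<le> l"
  shows "cycle_of_list [2..<Suc l] j = (if j = l then 2 else Suc j)"
proof -
  let ?c = "cycle_of_list [2..<Suc l]"
  define i where "i = j - 2"
  have i: "j = 2 + i" "i < l - 1" using assms by (auto simp: i_def)
  have "map ?c [2..<Suc l] = rotate1 [2..<Suc l]"
    using cyclic_rotation[of "[2..<Suc l]" 1] by simp
  then have "map ?c [2..<Suc l] ! i = rotate1 [2..<Suc l] ! i" by simp
  moreover have "map ?c [2..<Suc l] ! i = ?c j" using i by (simp del: upt_Suc)
  moreover have "rotate1 [2..<Suc l] ! i = (if j = l then 2 else Suc j)"
    using i by (cases "Suc i = l - 1") (auto simp: nth_rotate1 simp del: upt_Suc)
  ultimately show ?thesis by simp
qed

text \<open>As \<open>g\<close> sums to 0, pairing it with an overlined basis vector leaves only one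
  coordinate.\<close>

lemma aff_elem_ev:
  assumes g: "(g, 0, 0) \<in> hstar l" and \<sigma>: "\<sigma> permutes {1..l}"
  shows "aff_elem l (g, 0, 0) \<sigma> (ev k) =
    eps_bar l (\<sigma> (idx k)) - hscale (of_int (k div L) + g (\<sigma> (idx k))) delta"
proof -
  let ?i = "\<sigma> (idx k)"
  have i: "?i \<in> {1..l}" using permutes_in_image[OF \<sigma>] idx_range by blast
  have "perm_act \<sigma> (ev k) = eps_bar l ?i - hscale (of_int (k div L)) delta"
    unfolding ev_def by (simp only: perm_act_simps perm_act_eps_bar[OF \<sigma>])
  also have "\<dots> = (\<lambda>j. (if j = ?i then 1 else 0) - (if j \<in> {1..l} then 1 / of_nat l else 0), 0, - of_int (k div L))"
    unfolding eps_bar_eq delta_eq by (simp add: hvec_simps fun_eq_iff)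
  finally have p: "perm_act \<sigma> (ev k) = \<dots>" .
  have "(\<Sum>j=1..l. g j * ((if j = ?i then 1 else 0) - (if j \<in> {1..l} then 1 / of_nat l else 0)))
      = (\<Sum>j=1..l. (if j = ?i then g j else 0) - g j / of_nat l)"
    by (rule sum.cong) (auto simp: algebra_simps)
  also have "\<dots> = g ?i"
    using i g by (simp add: sum_subtractf hstar_iff flip: sum_divide_distrib)
  finally have s: "(\<Sum>j=1..l. g j * ((if j = ?i then 1 else 0) - (if j \<in> {1..l} then 1 / of_nat l else 0))) = g ?i" .
  have "aff_elem l (g, 0, 0) \<sigma> (ev k) = transl l (g, 0, 0) (perm_act \<sigma> (ev k))"
    by (simp add: aff_elem_def hstar_ev)
  then show ?thesis unfolding p transl_eq s eps_bar_eq delta_eq by (simp add: hvec_simps fun_eq_iff)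
qed

text \<open>The coordinates of \<open>eps_bar l 2\<close> at 1 to \<open>l\<close> are all
  \<open>-1/l\<close>, with 1 added at index 2. The common part gives the shift by
  \<open>\<delta>/l\<close>; the 1 raises the period of the residue \<open>N\<close>, whose index
  the cycle sends to 2.\<close>

lemma s_elem_isos: "s_elem l \<in> isos"
  and s_elem_ev: "s_elem l (ev k) = ev (tau k) + hscale (1 / of_nat l) delta"
proof -
  let ?c = "cycle_of_list [2..<Suc l]"
  define g :: "nat \<Rightarrow> complex" where "g = (\<lambda>j. (if j = 2 then 1 else 0) - (if j \<in> {1..l} then 1 / of_nat l else 0))"
  have eps: "eps_bar l 2 = (g, 0, 0)" by (simp add: eps_bar_eq g_def)
  have "set [2..<Suc l] \<subseteq> {1..l}" by auto
  then have c: "?c permutes {1..l}" by (rule permutes_subset[OF cycle_permutes])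
  have "eps_bar l 2 \<in> hstar l" using two_le_l by (intro hstar_eps_bar) simp
  then have g: "(g, 0, 0) \<in> hstar l" by (simp only: eps)
  show "s_elem l \<in> isos" unfolding s_elem_def eps by (rule aff_elem_isos[OF g c])
  have s: "s_elem l (ev k) = eps_bar l (?c (idx k)) - hscale (of_int (k div L) + g (?c (idx k))) delta"
    unfolding s_elem_def eps by (rule aff_elem_ev[OF g c])
  have b: "0 \<le> k mod L" "k mod L < L" using two_le_l by simp_all
  consider "k mod L = 0" | "k mod L = N" | "0 < k mod L" "k mod L < N" using b by linarith
  then show "s_elem l (ev k) = ev (tau k) + hscale (1 / of_nat l) delta"
  proof cases
    case 1
    then have i: "idx k = 1" by (simp add: idx_def)
    have "?c 1 = 1" by (rule id_outside_supp) simp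
    then show ?thesis unfolding s i using 1 two_le_l i
      by (simp add: tau_def ev_def g_def hscale_diff)
  next
    case 2
    then have i: "idx k = l" using two_le_l by (simp add: idx_def nat_diff_distrib)
    have t: "tau k = int 2 - 1 + (k div L + 1) * L"
      using 2 div_mult_mod_eq[of k L] N_pos unfolding tau_def by (simp add: distrib_right)
    have "idx (tau k) = 2" "tau k div L = k div L + 1" unfolding t using two_le_l by (intro idx_div_of; simp)+
    then show ?thesis unfolding s i using cycle_values[of l] two_le_l
      by (simp add: ev_def g_def hscale_add hscale_diff)
  next
    case 3
    define j where "j = idx k"
    have j: "int j = k mod L + 1" "2 \<le> j" "j < l" using 3 two_le_l by (auto simp: idx_def j_def)
    have t: "tau k = int (Suc j) - 1 + k div L * L" using 3 j div_mult_mod_eq[of k L] by (simp add: tau_def)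
    have "idx (tau k) = Suc j" "tau k div L = k div L" unfolding t using j by (intro idx_div_of; simp)+
    then show ?thesis unfolding s j_def[symmetric] using cycle_values[of j] j
      by (simp add: ev_def g_def hscale_diff)
  qed
qed

lemma rep_Ad_s_inv:
  assumes w: "rep w f" and f: "f \<circ> tau = tau \<circ> f'"
  shows "rep (Ad_s_inv l w) f'"
proof -
  let ?s = "s_elem l" and ?i = "inv\<^bsub>BG\<^esub> (s_elem l)"
  have w': "w \<in> isos" using w by (simp add: rep_def)
  have i: "?i \<in> isos" by (rule isos_inv[OF s_elem_isos])
  have iso: "Ad_s_inv l w \<in> isos" unfolding Ad_s_inv_def by (intro isos_mult i w' s_elem_isos)
  have "Ad_s_inv l w (ev (f' k)) = ev k" for k
  proof -
    have "tau (f' k) = f (tau k)" using fun_cong[OF f, of k] by simp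
    then have "w (?s (ev (f' k))) = w (ev (f (tau k)) + hscale (1 / of_nat l) delta)"
      by (simp add: s_elem_ev)
    \<comment> \<open>\<open>w\<close> is linear and fixes \<delta>, so the shift passes through it
      and is undone by the inverse of \<open>s\<close>.\<close>
    also have "\<dots> = ev (tau k) + hscale (1 / of_nat l) delta"
      using w by (simp add: isosD(3,5,6)[OF w'] hstar_ev hstar_scale hstar_delta rep_def)
    also have "\<dots> = ?s (ev k)" by (simp add: s_elem_ev)
    finally have eq: "w (?s (ev (f' k))) = ?s (ev k)" .
    have "Ad_s_inv l w (ev (f' k)) = ?i (w (?s (ev (f' k))))"
      unfolding Ad_s_inv_def
      by (simp add: BG_mult isosD(1,2) isos_mult i w' s_elem_isos hstar_ev)
    then show ?thesis unfolding eq by (simp add: BG_inv isosD(1) s_elem_isos hstar_ev)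
  qed
  then show ?thesis using iso by (simp add: rep_def)
qed

definition wperm :: "nat \<times> monomial \<Rightarrow> int \<Rightarrow> int" where
  "wperm X = arrange (allB (fst X)) (1 - int (fst X)) (snd X)"

lemma wperm_aff_perms: "wperm X \<in> aff_perms"
  unfolding wperm_def by (rule arrange_aff_perms[OF allB_aff_perms])

text \<open>Each \<open>B^-1\<close> moves the start of the word one step back in time:
  \<open>allB_tau\<close> handles the past and \<open>arrange_tau\<close> the word.\<close>

lemma rep_w_pair: "rep (w_pair l (n, M)) (wperm (n, M))"
proof (induction n)
  case 0
  show ?case using rep_w_good[of M] by (simp add: wperm_def)
next
  case (Suc n)
  \<comment> \<open>\<alpha>_12 is \<beta>_1, so its reflection acts as
    \<open>swp 1\<close>.\<close>
  have "fin_root l 1 2 = beta l (Suc 0)" by (simp add: beta_def numeral_2_eq_2)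
  then have "fin_root l 1 2 = ev 0 - ev (loc 1)" using beta_ev[of 0] by simp
  then have r: "rep (w_pair l (n, M) \<otimes>\<^bsub>BG\<^esub> reflection l (fin_root l 1 2)) (swp 1 \<circ> wperm (n, M))"
    using rep_mult[OF Suc rep_reflection[of 1]] by simp
  have "(swp 1 \<circ> wperm (n, M)) \<circ> tau = tau \<circ> wperm (Suc n, M)"
    using arrange_tau[OF allB_tau[of n], of "1 - int n" M] by (simp add: wperm_def arrange_comp)
  from rep_Ad_s_inv[OF r this] show ?case by simp
qed

section \<open>The affine Weyl group as permutations of displacement zero\<close>

lemma Q_fin_eq:
  "Q_fin l = {(\<lambda>i. of_int (c i), 0, 0) | c. (\<forall>i. i \<notin> {1..l} \<longrightarrow> c i = 0) \<and> (\<Sum>i=1..l. c i) = (0::int)}"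
    (is "_ = ?R")
proof
  have root: "simple_root l i = (\<lambda>j. (if j = i then 1 else 0) - (if j = Suc i then 1 else 0), 0, 0)"
    if "i \<noteq> 0" for i
    using that by (simp add: simple_root_def eps_bar_def eps_def fun_eq_iff zero_prod_def)
  have sum: "(\<Sum>i=1..<l. hscale (of_int (n i)) (simple_root l i)) =
      (\<lambda>j. of_int (\<Sum>i=1..<l. n i * ((if j = i then 1 else 0) - (if j = Suc i then 1 else 0))), 0, 0)" for n
  proof -
    have "(\<Sum>i=1..<l. hscale (of_int (n i)) (simple_root l i)) =
      (\<Sum>i=1..<l. (\<lambda>j. of_int (n i * ((if j = i then 1 else 0) - (if j = Suc i then 1 else 0))), 0, 0))"
      by (rule sum.cong) (auto simp: root hvec_scale fun_eq_iff)
    then show ?thesis unfolding hvec_sum by simp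
  qed
  show "Q_fin l \<subseteq> ?R"
  proof
    fix v assume "v \<in> Q_fin l"
    then obtain n where "v = (\<Sum>i=1..<l. hscale (of_int (n i)) (simple_root l i))"
      unfolding Q_fin_def by blast
    note v = this[unfolded sum]
    define c where "c j = (\<Sum>i=1..<l. n i * ((if j = i then 1 else 0) - (if j = Suc i then 1 else 0)))" for j
    have "(\<Sum>j=1..l. c j) = (\<Sum>i=1..<l. \<Sum>j=1..l. n i * ((if j = i then 1 else 0) - (if j = Suc i then 1 else 0)))"
      unfolding c_def by (rule sum.swap)
    also have "\<dots> = 0"
    proof (rule sum.neutral, rule ballI)
      fix i assume "i \<in> {1..<l}"
      then have "(\<Sum>j=1..l. (if j = i then 1 else 0) - (if j = Suc i then 1 else 0)) = (0 :: int)"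
        by (simp add: sum_subtractf)
      then show "(\<Sum>j=1..l. n i * ((if j = i then 1 else 0) - (if j = Suc i then 1 else 0))) = 0"
        by (simp only: sum_distrib_left[symmetric] mult_zero_right)
    qed
    finally have "(\<Sum>j=1..l. c j) = 0" .
    moreover have "c j = 0" if "j \<notin> {1..l}" for j
      unfolding c_def using that by (intro sum.neutral) auto
    ultimately show "v \<in> ?R" unfolding v c_def[symmetric] by blast
  qed
  show "?R \<subseteq> Q_fin l"
  proof
    fix v assume "v \<in> ?R"
    then obtain c where v: "v = (\<lambda>i. of_int (c i), 0, 0)"
      and c: "\<And>i. i \<notin> {1..l} \<Longrightarrow> c i = 0" "(\<Sum>i=1..l. c i) = 0" by blast
    \<comment> \<open>Abel summation: the coefficients of the simple roots are partial sums, with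
      \<open>n l = 0\<close> because \<open>c\<close> sums to 0.\<close>
    define n where "n i = (\<Sum>j=1..i. c j)" for i
    have "(\<Sum>i=1..<l. n i * ((if j = i then 1 else 0) - (if j = Suc i then 1 else 0))) = c j" for j
    proof -
      have "(\<Sum>i=1..<l. n i * ((if j = i then 1 else 0) - (if j = Suc i then 1 else 0)))
        = (\<Sum>i=1..<l. if i = j then n i else 0) - (\<Sum>i=1..<l. if i = j - 1 then (if j = 0 then 0 else n i) else 0)"
        unfolding sum_subtractf[symmetric] by (rule sum.cong) (auto split: if_splits)
      also have "\<dots> = (if j \<in> {1..<l} then n j else 0) - (if j - 1 \<in> {1..<l} then n (j - 1) else 0)"
        by auto
      also have "\<dots> = c j"
      proof -
        have Suc: "n (Suc i) = n i + c (Suc i)" for i by (simp add: n_def)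
        have "n l = 0" "n 0 = 0" "c 0 = 0" using c by (simp_all add: n_def)
        obtain i where i: "j = 0 \<or> j = Suc i" by (cases j) auto
        then consider "j = 0" | "j = Suc i" "j < l" | "j = Suc i" "j = l" | "l < j" by linarith
        then show ?thesis
        proof cases
          case 1
          then show ?thesis using c(1)[of 0] by simp
        next
          case 2
          then show ?thesis using Suc[of i] \<open>n 0 = 0\<close> by (cases i) auto
        next
          case 3
          then show ?thesis using Suc[of i] \<open>n l = 0\<close> two_le_l by auto
        next
          case 4
          then show ?thesis using c(1)[of j] by auto
        qed
      qed
      finally show ?thesis .
    qed
    then have "v = (\<Sum>i=1..<l. hscale (of_int (n i)) (simple_root l i))" unfolding sum v by simp
    then show "v \<in> Q_fin l" unfolding Q_fin_def by blast
  qed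
qed

lemma bij_betw_shift: "bij_betw (\<lambda>j. int j - 1) {1..l} {0..<L}"
  by (rule bij_betw_byWitness[where f' = "\<lambda>k. nat k + 1"]) auto

text \<open>Reduction modulo \<open>L\<close> permutes the residues of one period, so only the
  quotients contribute.\<close>

lemma sum_mod_cancel:
  assumes "bij_betw (\<lambda>k. u k mod L) {0..<L} {0..<L}"
  shows "disp u = L * (\<Sum>k\<in>{0..<L}. u k div L)"
proof -
  have "(\<Sum>k\<in>{0..<L}. u k) = (\<Sum>k\<in>{0..<L}. u k mod L + L * (u k div L))" by simp
  also have "\<dots> = (\<Sum>k\<in>{0..<L}. u k mod L) + L * (\<Sum>k\<in>{0..<L}. u k div L)"
    by (simp only: sum.distrib sum_distrib_left)
  also have "(\<Sum>k\<in>{0..<L}. u k mod L) = (\<Sum>k\<in>{0..<L}. k)"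
    using sum.reindex_bij_betw[OF assms, of "\<lambda>k. k"] by simp
  finally show ?thesis unfolding disp_def sum_subtractf by simp
qed

text \<open>\<open>u\<close> is the action on integers: \<sigma> permutes the residues, and the
  translation adds \<open>c\<close> periods at the new residue.\<close>

lemma aff_elem_of_perm:
  assumes \<sigma>: "\<sigma> permutes {1..l}" and c: "\<And>i. i \<notin> {1..l} \<Longrightarrow> c i = 0" "(\<Sum>i=1..l. c i) = (0::int)"
    and u: "\<And>k. u k = int (\<sigma> (idx k)) - 1 + (k div L + c (\<sigma> (idx k))) * L"
  shows "aff_elem l (\<lambda>i. of_int (c i), 0, 0) \<sigma> \<in> affine_weyl l"
    and "aff_elem l (\<lambda>i. of_int (c i), 0, 0) \<sigma> \<in> isos"
    and "aff_elem l (\<lambda>i. of_int (c i), 0, 0) \<sigma> (ev k) = ev (u k)"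
proof -
  have h: "(\<lambda>i. of_int (c i), 0, 0) \<in> hstar l"
    unfolding hstar_iff using c by (simp flip: of_int_sum)
  show "aff_elem l (\<lambda>i. of_int (c i), 0, 0) \<sigma> \<in> isos" by (rule aff_elem_isos[OF h \<sigma>])
  have "(\<lambda>i. of_int (c i), 0, 0) \<in> Q_fin l" unfolding Q_fin_eq using c by blast
  then show "aff_elem l (\<lambda>i. of_int (c i), 0, 0) \<sigma> \<in> affine_weyl l"
    unfolding affine_weyl_def using \<sigma> by blast
  have i: "\<sigma> (idx k) \<in> {1..l}" using permutes_in_image[OF \<sigma>] idx_range by blast
  have "idx (u k) = \<sigma> (idx k)" "u k div L = k div L + c (\<sigma> (idx k))"
    unfolding u by (rule idx_div_of[OF i])+
  then show "aff_elem l (\<lambda>i. of_int (c i), 0, 0) \<sigma> (ev k) = ev (u k)"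
    unfolding aff_elem_ev[OF h \<sigma>] by (simp add: ev_def)
qed

lemma aff_perms_of_perm:
  assumes \<sigma>: "\<sigma> permutes {1..l}" and c: "(\<Sum>i=1..l. c i) = (0::int)"
    and u: "\<And>k. u k = int (\<sigma> (idx k)) - 1 + (k div L + c (\<sigma> (idx k))) * L"
  shows "u \<in> aff_perms"
proof -
  have i: "\<sigma> (idx k) \<in> {1..l}" for k using permutes_in_image[OF \<sigma>] idx_range by blast
  have ui: "idx (u k) = \<sigma> (idx k)" "u k div L = k div L + c (\<sigma> (idx k))" for k
    unfolding u by (rule idx_div_of[OF i])+
  have "inj u"
  proof (rule injI)
    fix k k' assume eq: "u k = u k'"
    then have "\<sigma> (idx k) = \<sigma> (idx k')" using ui(1) by metis
    then have idx: "idx k = idx k'" using permutes_inj[OF \<sigma>] by (simp add: inj_eq)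
    then have "k div L = k' div L" using ui(2)[of k] ui(2)[of k'] eq by simp
    then have "int (idx k) - 1 + k div L * L = int (idx k') - 1 + k' div L * L" using idx by simp
    then show "k = k'" by (simp only: idx_decomp)
  qed
  moreover have "surj u"
  proof (rule surjI)
    fix y
    let ?j = "inv_into UNIV \<sigma> (idx y)"
    have j: "?j \<in> {1..l}" using permutes_in_image[OF permutes_inv[OF \<sigma>]] idx_range by blast
    have \<sigma>j: "\<sigma> ?j = idx y" by (rule permutes_inverses[OF \<sigma>])
    \<comment> \<open>The preimage: undo \<sigma> on the residue and take off the periods added
      there.\<close>
    show "u (int ?j - 1 + (y div L - c (idx y)) * L) = y"
      unfolding u idx_div_of[OF j] \<sigma>j by (simp only: diff_add_cancel idx_decomp)
  qed
  moreover have "u (k + L) = u k + L" for k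
  proof -
    have "idx (k + L) = idx k" "(k + L) div L = k div L + 1" using idx_shift[of k 1] two_le_l by simp_all
    then show ?thesis unfolding u by (simp add: algebra_simps)
  qed
  ultimately have eq: "affine_bij u" by (simp add: affine_bij_def bij_def)
  have "disp u = L * (\<Sum>k\<in>{0..<L}. u k div L)" by (rule sum_mod_cancel[OF bij_betw_affine_bij_mod[OF eq]])
  also have "(\<Sum>k\<in>{0..<L}. u k div L) = (\<Sum>j=1..l. u (int j - 1) div L)"
    by (rule sum.reindex_bij_betw[OF bij_betw_shift, symmetric])
  also have "\<dots> = (\<Sum>j=1..l. c (\<sigma> j))"
  proof (rule sum.cong[OF refl])
    fix j assume "j \<in> {1..l}"
    then show "u (int j - 1) div L = c (\<sigma> j)" using idx_div_of[of j 0] ui(2)[of "int j - 1"] by simp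
  qed
  also have "\<dots> = 0" using sum.permute[OF \<sigma>, of c] c by (simp add: o_def)
  finally show ?thesis using eq by (simp add: aff_perms_def)
qed

text \<open>The residues of \<open>u\<close> over one period give \<sigma>, the quotients give
  \<open>c\<close>, and zero displacement gives the zero sum.\<close>

lemma perm_of_aff_perms:
  assumes u: "u \<in> aff_perms"
  obtains \<sigma> c where "\<sigma> permutes {1..l}" "\<And>i. i \<notin> {1..l} \<Longrightarrow> c i = 0" "(\<Sum>i=1..l. c i) = (0::int)"
    "\<And>k. u k = int (\<sigma> (idx k)) - 1 + (k div L + c (\<sigma> (idx k))) * L"
proof -
  have eq: "affine_bij u" using u by (simp add: aff_perms_def)
  define \<sigma> where "\<sigma> j = (if j \<in> {1..l} then idx (u (int j - 1)) else j)" for j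
  \<comment> \<open>\<open>c\<close> is indexed by the residue after \<sigma>, hence the inverse
    permutation.\<close>
  define c where "c i = (if i \<in> {1..l} then u (int (inv_into UNIV \<sigma> i) - 1) div L else 0)" for i
  have "inj_on \<sigma> {1..l}"
  proof (rule inj_onI)
    fix i j assume ij: "i \<in> {1..l}" "j \<in> {1..l}" "\<sigma> i = \<sigma> j"
    then have "(int i - 1) mod L = (int j - 1) mod L"
      by (simp add: \<sigma>_def idx_eq_iff affine_bij_cong[OF eq])
    moreover have "(int i - 1) mod L = int i - 1" "(int j - 1) mod L = int j - 1"
      using ij(1,2) by simp_all
    ultimately show "i = j" by simp
  qed
  moreover have "\<sigma> ` {1..l} \<subseteq> {1..l}" using idx_range by (auto simp: \<sigma>_def)
  ultimately have "bij_betw \<sigma> {1..l} {1..l}" by (simp add: bij_betw_def endo_inj_surj)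
  then have \<sigma>: "\<sigma> permutes {1..l}" by (rule bij_imp_permutes) (auto simp: \<sigma>_def)
  have c\<sigma>: "c (\<sigma> j) = u (int j - 1) div L" if "j \<in> {1..l}" for j
    using permutes_in_image[OF \<sigma>, of j] that by (simp add: c_def permutes_inverses[OF \<sigma>])
  have "L * (\<Sum>k\<in>{0..<L}. u k div L) = 0"
    using sum_mod_cancel[OF bij_betw_affine_bij_mod[OF eq]] u by (simp add: aff_perms_def)
  moreover have "(\<Sum>k\<in>{0..<L}. u k div L) = (\<Sum>j=1..l. u (int j - 1) div L)"
    by (rule sum.reindex_bij_betw[OF bij_betw_shift, symmetric])
  moreover have "\<dots> = (\<Sum>j=1..l. c (\<sigma> j))" by (rule sum.cong) (simp_all add: c\<sigma>)
  moreover have "\<dots> = (\<Sum>i=1..l. c i)" using sum.permute[OF \<sigma>, of c] by (simp add: o_def)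
  ultimately have c_sum: "(\<Sum>i=1..l. c i) = 0" using two_le_l by simp
  have c_supp: "c i = 0" if "i \<notin> {1..l}" for i using that unfolding c_def by (rule if_not_P)
  have u_eq: "u k = int (\<sigma> (idx k)) - 1 + (k div L + c (\<sigma> (idx k))) * L" for k
  proof -
    let ?v = "u (int (idx k) - 1)"
    have "u k = ?v + k div L * L" 
      using affine_bij_shift[OF eq, of "int (idx k) - 1" "k div L"] by (simp only: idx_decomp)
    moreover have "?v = int (\<sigma> (idx k)) - 1 + c (\<sigma> (idx k)) * L"
    proof -
      have \<sigma>v: "\<sigma> (idx k) = idx ?v" using idx_range[of k] by (simp only: \<sigma>_def if_True)
      have cv: "c (\<sigma> (idx k)) = ?v div L" by (rule c\<sigma>[OF idx_range])
      show ?thesis unfolding cv unfolding \<sigma>v by (rule idx_decomp[symmetric])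
    qed
    ultimately show ?thesis by (simp add: algebra_simps)
  qed
  show ?thesis by (rule that[OF \<sigma> c_supp c_sum u_eq])
qed


lemma affine_weyl_rep:
  assumes "g \<in> affine_weyl l"
  obtains f where "f \<in> aff_perms" "rep g f"
proof -
  obtain \<gamma> \<sigma> where g: "g = aff_elem l \<gamma> \<sigma>" "\<gamma> \<in> Q_fin l" and \<sigma>: "\<sigma> permutes {1..l}"
    using assms unfolding affine_weyl_def by blast
  obtain c where \<gamma>: "\<gamma> = (\<lambda>i. of_int (c i), 0, 0)"
    and c: "\<And>i. i \<notin> {1..l} \<Longrightarrow> c i = 0" "(\<Sum>i=1..l. c i) = (0::int)"
    using g(2) unfolding Q_fin_eq by blast
  define u where "u k = int (\<sigma> (idx k)) - 1 + (k div L + c (\<sigma> (idx k))) * L" for k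
  have u: "u \<in> aff_perms" by (rule aff_perms_of_perm[OF \<sigma> c(2) u_def])
  have "surj u" using u by (simp add: aff_perms_def affine_bij_def bij_is_surj)
  then have "rep g (inv_into UNIV u)"
    using aff_elem_of_perm(2,3)[OF \<sigma> c u_def] unfolding rep_def g(1) \<gamma>
    by (simp add: surj_f_inv_f)
  then show ?thesis using that aff_perms_inv[OF u] by blast
qed

text \<open>Reading \<sigma> and \<open>c\<close> off the inverse of \<open>f\<close> gives an
  element of the affine Weyl group represented by \<open>f\<close>; \<open>rep_unique\<close>
  identifies it with \<open>g\<close>.\<close>

lemma rep_affine_weyl:
  assumes g: "rep g f" and f: "f \<in> aff_perms"
  shows "g \<in> affine_weyl l"
proof -
  have bij: "bij f" using f by (simp add: aff_perms_def affine_bij_def)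
  obtain \<sigma> c where \<sigma>: "\<sigma> permutes {1..l}"
    and c: "\<And>i. i \<notin> {1..l} \<Longrightarrow> c i = 0" "(\<Sum>i=1..l. c i) = (0::int)"
    and u: "\<And>k. inv_into UNIV f k = int (\<sigma> (idx k)) - 1 + (k div L + c (\<sigma> (idx k))) * L"
    using perm_of_aff_perms[OF aff_perms_inv[OF f]] by blast
  have "rep (aff_elem l (\<lambda>i. of_int (c i), 0, 0) \<sigma>) f"
    using aff_elem_of_perm(2,3)[OF \<sigma> c u] bij by (simp add: rep_def bij_is_inj)
  then have "g = aff_elem l (\<lambda>i. of_int (c i), 0, 0) \<sigma>"
    using rep_unique[OF g] bij by (simp add: bij_is_surj)
  then show ?thesis using aff_elem_of_perm(1)[OF \<sigma> c u] by simp
qed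

section \<open>The map on translated good monomials\<close>

lemma good_replicate: "M \<in> good_monomials l \<Longrightarrow> replicate n LB @ M \<in> good_monomials l"
proof (induction n)
  case (Suc n)
  define M' where "M' = replicate n LB @ M"
  have M': "good l M'" "M' = [] \<or> last M' = LB"
    using Suc by (auto simp: M'_def good_monomials_def)
  have "good l (LB # M')" unfolding good_def
  proof (intro allI impI)
    fix i assume "i + (l - 1) < length (LB # M')" "(LB # M') ! i = LA"
    then show "(LB # M') ! (i + (l - 1)) = LA"
      using M'(1) by (cases i) (auto simp: good_def)
  qed
  then show ?case using M' by (auto simp: good_monomials_def M'_def)
qed simp

lemma wperm_replicate: "wperm (n, M) = wperm (n + k, replicate k LB @ M)"
  using allB_replicate[of n k] by (simp add: wperm_def arrange_append)

text \<open>Both sides are brought to the exponent \<open>n + n'\<close>, where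
  \<open>arrange_allB_inj\<close> compares plain words.\<close>

lemma wperm_eq_iff:
  assumes "M \<in> good_monomials l" "M' \<in> good_monomials l"
  shows "wperm (n, M) = wperm (n', M') \<longleftrightarrow> ((n, M), (n', M')) \<in> translate_rel l"
proof -
  let ?X = "replicate n' LB @ M" and ?Y = "replicate n LB @ M'"
  have "wperm (n, M) = wperm (n', M') \<longleftrightarrow> wperm (n + n', ?X) = wperm (n + n', ?Y)"
    using wperm_replicate[of n M n'] wperm_replicate[of n' M' n] by (simp add: add.commute)
  also have "\<dots> \<longleftrightarrow> ?X = ?Y"
    using arrange_allB_inj[OF good_replicate[OF assms(1)] good_replicate[OF assms(2)], where n = "n + n'"]
    by (auto simp: wperm_def)
  finally show ?thesis using assms by (simp add: translate_rel_def)
qed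

text \<open>One direction makes \<open>w_map\<close> well defined on classes, the other makes it
  injective.\<close>

lemma w_pair_eq_iff:
  assumes "M \<in> good_monomials l" "M' \<in> good_monomials l"
  shows "w_pair l (n, M) = w_pair l (n', M') \<longleftrightarrow> ((n, M), (n', M')) \<in> translate_rel l"
  unfolding wperm_eq_iff[OF assms, symmetric]
proof
  assume "w_pair l (n, M) = w_pair l (n', M')"
  then show "wperm (n, M) = wperm (n', M')"
    using rep_inj rep_w_pair by metis
next
  assume eq: "wperm (n, M) = wperm (n', M')"
  have "surj (wperm (n', M'))" using wperm_aff_perms[of "(n', M')"] by (simp add: aff_perms_def affine_bij_def bij_is_surj)
  then show "w_pair l (n, M) = w_pair l (n', M')"
    using rep_unique[OF rep_w_pair[of n M, unfolded eq] rep_w_pair] by blast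
qed

lemma w_map_class:
  assumes "M \<in> good_monomials l"
  shows "w_map l (translate_rel l `` {(n, M)}) = w_pair l (n, M)"
proof -
  have "w_pair l ` (translate_rel l `` {(n, M)}) = {w_pair l (n, M)}"
  proof (intro equalityI subsetI)
    fix g assume "g \<in> w_pair l ` (translate_rel l `` {(n, M)})"
    then obtain n' M' where g: "g = w_pair l (n', M')" and rel: "((n, M), (n', M')) \<in> translate_rel l"
      by auto
    then have "M' \<in> good_monomials l" by (simp add: translate_rel_def)
    with assms have "w_pair l (n, M) = w_pair l (n', M')" using w_pair_eq_iff rel by blast
    then show "g \<in> {w_pair l (n, M)}" using g by simp
  qed (use assms in \<open>auto simp: translate_rel_def\<close>)
  then show ?thesis by (simp add: w_map_def)
qed

lemma bij_betw_w_map: "bij_betw (w_map l) (translated_good_monomials l) (affine_weyl l)"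
  unfolding bij_betw_def
proof
  have cls: "\<exists>n M. M \<in> good_monomials l \<and> X = translate_rel l `` {(n, M)}"
    if "X \<in> translated_good_monomials l" for X
    using that unfolding translated_good_monomials_def quotient_def by auto
  show "inj_on (w_map l) (translated_good_monomials l)"
  proof (rule inj_onI)
    fix X Y assume XY: "X \<in> translated_good_monomials l" "Y \<in> translated_good_monomials l"
      and eq: "w_map l X = w_map l Y"
    from XY cls obtain n M n' M' where M: "M \<in> good_monomials l" "M' \<in> good_monomials l"
      and X: "X = translate_rel l `` {(n, M)}" "Y = translate_rel l `` {(n', M')}" by metis
    then have "((n, M), (n', M')) \<in> translate_rel l"
      using eq w_map_class w_pair_eq_iff by simp
    then show "X = Y" unfolding X by (rule equiv_class_eq[OF equiv_translate_rel])
  qed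
  show "w_map l ` translated_good_monomials l = affine_weyl l"
  proof (intro equalityI subsetI)
    fix g assume "g \<in> w_map l ` translated_good_monomials l"
    then obtain n M where "M \<in> good_monomials l" "g = w_pair l (n, M)"
      using cls w_map_class by fastforce
    then show "g \<in> affine_weyl l" using rep_affine_weyl[OF rep_w_pair wperm_aff_perms] by simp
  next
    fix g assume "g \<in> affine_weyl l"
    then obtain f where f: "f \<in> aff_perms" "rep g f" by (rule affine_weyl_rep)
    obtain n M where M: "M \<in> good_monomials l" and "arrange (allB n) (1 - int n) M = f"
      by (rule arrange_allB_surj[OF f(1)])
    then have "rep (w_pair l (n, M)) f" using rep_w_pair[of n M] by (simp add: wperm_def)
    moreover have "surj f" using f(1) by (simp add: aff_perms_def affine_bij_def bij_is_surj)
    ultimately have "g = w_map l (translate_rel l `` {(n, M)})"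
      using rep_unique[OF f(2)] w_map_class[OF M] by simp
    moreover have "translate_rel l `` {(n, M)} \<in> translated_good_monomials l"
      unfolding translated_good_monomials_def using M by (intro quotientI) simp
    ultimately show "g \<in> w_map l ` translated_good_monomials l" by blast
  qed
qed

end

theorem corollary2p9:
  fixes l :: nat
  assumes "l \<ge> 2"
  shows "bij_betw (w_map l) (translated_good_monomials l) (affine_weyl l)"
proof -
  interpret affine_rank l by unfold_locales (rule assms)
  show ?thesis by (rule bij_betw_w_map)
qed

end
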